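(* Let $\Omega\subset\mathbb{H}_1$ be a domain and let $V=v_1X+v_2Y-4v_0T$ be a smooth (real) contact vector field on $\Omega$. Then the following are equivalent: (1) $V$ is conformal; (2) $X^2v_0=Y^2v_0$ and $XYv_0=-YXv_0$ in $\Omega$; (3) $Z^2v_0=0$ in $\Omega$; (4) there are real constants $c_1,\dots,c_8$ such that in $\Omega$ $$v_0(x,y,t)=c_1(x^4+2x^2y^2+y^4+t^2)+c_2(ty-xy^2-x^3)+c_3(tx+x^2y+y^3)+c_4(x^2+y^2)+c_5x+c_6y+c_7t+c_8 .$$
   Context: The Heisenberg group $\mathbb{H}_1$ is $\mathbb{C}\times\mathbb{R}$ with coordinates $(z,t)$, $z=x+iy$, and product $(z_1,t_1)(z_2,t_2)=(z_1+z_2,\,t_1+t_2+2\,\mathrm{Im}(z_1\bar z_2))$. Put $X=\partial_x+2y\,\partial_t$, $Y=\partial_y-2x\,\partial_t$, $T=\partial_t$, $Z=\frac12(X-iY)$, $\theta=dt-2y\,dx+2x\,dy$; the horizontal bundle $\mathcal{H}$ is spanned by $X,Y$. A domain is a nonempty connected open set. A local diffeomorphism $f=(f_1+if_2,f_3)$ between open subsets of $\mathbb{H}_1$ is a contact transformation if $f^*\theta=\lambda_f\theta$ with $\lambda_f$ nowhere zero; it is conformal if in addition $(Xf_1)^2+(Xf_2)^2=(Yf_1)^2+(Yf_2)^2$ and $(Xf_1)(Yf_1)+(Xf_2)(Yf_2)=0$. A vector field $V$ with real-valued coefficients is a contact vector field if its (local) flow consists of contact transformations, equivalently $[V,\mathcal{H}]\subseteq\mathcal{H}$,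 which for $V=v_1X+v_2Y-4v_0T$ means $Xv_0=-v_2$, $Yv_0=v_1$. A contact vector field is conformal if its (local) flow consists of conformal maps. *)

theory Defs
  imports "HOL-Analysis.Analysis"
begin

text \<open>The first Heisenberg group as a manifold; a point \<open>(Complex x y, t)\<close> has
  coordinates \<open>(x, y, t)\<close>.\<close>

type_synonym heis = "complex \<times> real"


text \<open>Iterated Frechet differentiability, meaningful for open \<open>S\<close>: all iterated
  directional derivatives up to order \<open>k\<close> exist and are continuous.\<close>

primrec Ck_on :: "nat \<Rightarrow> 'a::real_normed_vector set \<Rightarrow> ('a \<Rightarrow> 'b::real_normed_vector) \<Rightarrow> bool" where
  "Ck_on 0 S f \<longleftrightarrow> continuous_on S f"
| "Ck_on (Suc k) S f \<longleftrightarrow>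
     (\<forall>p\<in>S. f differentiable (at p)) \<and>
     (\<forall>w. Ck_on k S (\<lambda>p. frechet_derivative f (at p) w))"

definition smooth_on :: "'a::real_normed_vector set \<Rightarrow> ('a \<Rightarrow> 'b::real_normed_vector) \<Rightarrow> bool" where
  "smooth_on S f \<longleftrightarrow> (\<forall>k. Ck_on k S f)"


text \<open>Vector fields are maps into \<open>heis\<close>, the tangent spaces being identified with \<open>heis\<close>
  through the coordinate frame \<open>(1, 0)\<close>, \<open>(\<i>, 0)\<close>, \<open>(0, 1)\<close>, that is
  \<open>\<partial>\<^sub>x\<close>, \<open>\<partial>\<^sub>y\<close>, \<open>\<partial>\<^sub>t\<close>; they act on functions as derivations.\<close>

definition fieldX :: "heis \<Rightarrow> heis" where
  "fieldX p = (1, 0) + (2 * Im (fst p)) *\<^sub>R (0, 1)"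

definition fieldY :: "heis \<Rightarrow> heis" where
  "fieldY p = (\<i>, 0) - (2 * Re (fst p)) *\<^sub>R (0, 1)"

definition fieldT :: "heis \<Rightarrow> heis" where
  "fieldT p = (0, 1)"

definition deriv_along :: "(heis \<Rightarrow> heis) \<Rightarrow> (heis \<Rightarrow> 'b::real_normed_vector) \<Rightarrow> heis \<Rightarrow> 'b" where
  "deriv_along W f p = frechet_derivative f (at p) (W p)"

abbreviation opX :: "(heis \<Rightarrow> 'b::real_normed_vector) \<Rightarrow> heis \<Rightarrow> 'b" where
  "opX \<equiv> deriv_along fieldX"

abbreviation opY :: "(heis \<Rightarrow> 'b::real_normed_vector) \<Rightarrow> heis \<Rightarrow> 'b" where
  "opY \<equiv> deriv_along fieldY"

definition opZ :: "(heis \<Rightarrow> complex) \<Rightarrow> heis \<Rightarrow> complex" where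
  "opZ f p = (1/2) * (opX f p - \<i> * opY f p)"

text \<open>\<open>contact_form p w\<close> is the value on the tangent vector \<open>w\<close> at \<open>p\<close> of
  \<open>\<theta> = dt - 2y dx + 2x dy\<close>.\<close>

definition contact_form :: "heis \<Rightarrow> heis \<Rightarrow> real" where
  "contact_form p w = snd w - 2 * Im (fst p) * Re (fst w) + 2 * Re (fst p) * Im (fst w)"


definition local_diffeo_on :: "heis set \<Rightarrow> (heis \<Rightarrow> heis) \<Rightarrow> bool" where
  "local_diffeo_on U f \<longleftrightarrow>
     open U \<and> smooth_on U f \<and>
     (\<forall>p\<in>U. \<exists>W g. open W \<and> p \<in> W \<and> W \<subseteq> U \<and> open (f ` W) \<and>
        smooth_on (f ` W) g \<and> (\<forall>q\<in>W. g (f q) = q))"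

definition contact_map_on :: "heis set \<Rightarrow> (heis \<Rightarrow> heis) \<Rightarrow> bool" where
  "contact_map_on U f \<longleftrightarrow>
     local_diffeo_on U f \<and>
     (\<exists>l :: heis \<Rightarrow> real. \<forall>p\<in>U. l p \<noteq> 0 \<and>
        (\<forall>w. contact_form (f p) (frechet_derivative f (at p) w) = l p * contact_form p w))"

definition conformal_map_on :: "heis set \<Rightarrow> (heis \<Rightarrow> heis) \<Rightarrow> bool" where
  "conformal_map_on U f \<longleftrightarrow>
     contact_map_on U f \<and>
     (let f1 = (\<lambda>q. Re (fst (f q))); f2 = (\<lambda>q. Im (fst (f q))) in
      \<forall>p\<in>U. (opX f1 p)\<^sup>2 + (opX f2 p)\<^sup>2 = (opY f1 p)\<^sup>2 + (opY f2 p)\<^sup>2 \<and>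
             opX f1 p * opY f1 p + opX f2 p * opY f2 p = 0)"


definition local_flow ::
  "heis set \<Rightarrow> (heis \<Rightarrow> heis) \<Rightarrow> real set \<Rightarrow> heis set \<Rightarrow> (real \<Rightarrow> heis \<Rightarrow> heis) \<Rightarrow> bool" where
  "local_flow \<Omega> V J U \<Phi> \<longleftrightarrow>
     open J \<and> is_interval J \<and> 0 \<in> J \<and> open U \<and> U \<subseteq> \<Omega> \<and>
     smooth_on (J \<times> U) (\<lambda>(s, p). \<Phi> s p) \<and>
     (\<forall>p\<in>U. \<Phi> 0 p = p) \<and>
     (\<forall>s\<in>J. \<forall>p\<in>U. \<Phi> s p \<in> \<Omega> \<and>
        ((\<lambda>r. \<Phi> r p) has_vector_derivative V (\<Phi> s p)) (at s))"

text \<open>The local flow of \<open>V\<close> consists of maps with property \<open>P\<close>: there is a local flow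
  around every point, and every map of every local flow satisfies \<open>P\<close>.
  For smooth \<open>V\<close> on open \<open>\<Omega>\<close> the first conjunct always holds, by the classical existence
  theorem for flows; it is explicit so that the second conjunct is visibly not vacuous.\<close>

definition flow_consists_of ::
  "(heis set \<Rightarrow> (heis \<Rightarrow> heis) \<Rightarrow> bool) \<Rightarrow> heis set \<Rightarrow> (heis \<Rightarrow> heis) \<Rightarrow> bool" where
  "flow_consists_of P \<Omega> V \<longleftrightarrow>
     (\<forall>p\<in>\<Omega>. \<exists>J U \<Phi>. p \<in> U \<and> local_flow \<Omega> V J U \<Phi>) \<and>
     (\<forall>J U \<Phi>. local_flow \<Omega> V J U \<Phi> \<longrightarrow> (\<forall>s\<in>J. P U (\<Phi> s)))"

definition contact_field_on :: "heis set \<Rightarrow> (heis \<Rightarrow> heis) \<Rightarrow> bool" where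
  "contact_field_on \<Omega> V \<longleftrightarrow> flow_consists_of contact_map_on \<Omega> V"

definition conformal_field_on :: "heis set \<Rightarrow> (heis \<Rightarrow> heis) \<Rightarrow> bool" where
  "conformal_field_on \<Omega> V \<longleftrightarrow>
     contact_field_on \<Omega> V \<and> flow_consists_of conformal_map_on \<Omega> V"

end

theory Submission
  imports Defs
begin

text \<open>
  Differentiating \<open>\<theta>(D\<Phi>\<^sub>s W) = 0\<close> at \<open>s = 0\<close> for \<open>W = X, Y\<close> gives \<open>X v\<^sub>0 = -v\<^sub>2\<close> and \<open>Y v\<^sub>0 = v\<^sub>1\<close>, so that (2) is
  the Cauchy--Riemann system \<open>X v\<^sub>1 = Y v\<^sub>2\<close>, \<open>Y v\<^sub>1 = -X v\<^sub>2\<close>. Let \<open>h\<close> and \<open>k\<close> be the horizontal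
  components of \<open>D\<Phi>\<^sub>s X\<close> and \<open>D\<Phi>\<^sub>s Y\<close>, read as complex functions of \<open>s\<close>. The variational equation
  along the flow shows that conformality at first order in \<open>s\<close> is exactly this system. Conversely,
  under the system \<open>h\<close> and \<open>k\<close> solve the same linear equation \<open>u' = c u\<close> with a complex coefficient,
  whence \<open>k = \<i> h\<close>, as this holds at \<open>s = 0\<close>.

  For (4), the relations \<open>[X, Y] = -4T\<close> and \<open>[X, T] = [Y, T] = 0\<close> turn (2) into \<open>X Y u = -2 T u\<close>,
  \<open>Y X u = 2 T u\<close>, and from these \<open>X\<^sup>3 u = -6 T Y u\<close>, \<open>Y X\<^sup>2 u = 6 T X u\<close>, \<open>T X\<^sup>2 u = 0\<close> and
  \<open>T\<^sup>2 X u = T\<^sup>2 Y u = T\<^sup>3 u = 0\<close> follow. The functions \<open>T\<^sup>2 u\<close>, \<open>T X u\<close>, \<open>T Y u\<close>, \<open>T u\<close>, \<open>X\<^sup>2 u\<close>, \<open>X u\<close>, \<open>Y u\<close>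
  and \<open>u\<close>, in this order, are therefore determined up to one real constant each by the preceding
  ones, as the domain is connected.
\<close>

section \<open>Smooth functions\<close>

lemma frechet_derivative_eq:
  "(f has_derivative D) (at p) \<Longrightarrow> frechet_derivative f (at p) = D"
  by (metis frechet_derivative_at)

text \<open>\<open>frechet_derivative\<close> is a choice from the derivatives of \<open>f\<close>
  at \<open>p\<close>. Functions that agree near \<open>p\<close> have the same derivatives there,
  so the choice is the same, even where no derivative exists.\<close>

lemma frechet_derivative_cong_open:
  assumes "open S" "p \<in> S" "\<And>q. q \<in> S \<Longrightarrow> f q = g q"
  shows "frechet_derivative f (at p) = frechet_derivative g (at p)"
proof -
  have "(f has_derivative D) (at p) \<longleftrightarrow> (g has_derivative D) (at p)" for D
    using has_derivative_transform_within_open[OF _ assms(1,2)] assms(3) by metis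
  then show ?thesis by (simp add: frechet_derivative_def)
qed

lemma differentiable_bounded_linear_compose:
  "bounded_linear L \<Longrightarrow> f differentiable (at p) \<Longrightarrow> (\<lambda>q. L (f q)) differentiable (at p)"
  unfolding differentiable_def by (blast intro: bounded_linear.has_derivative)

lemma differentiable_bilinear:
  "bounded_bilinear B \<Longrightarrow> f differentiable (at p) \<Longrightarrow> g differentiable (at p) \<Longrightarrow>
    (\<lambda>q. B (f q) (g q)) differentiable (at p)"
  unfolding differentiable_def by (blast intro: bounded_bilinear.FDERIV)

lemma frechet_derivative_bounded_linear_compose:
  assumes "bounded_linear L" "f differentiable (at p)"
  shows "frechet_derivative (\<lambda>q. L (f q)) (at p) = (\<lambda>w. L (frechet_derivative f (at p) w))"
  by (rule frechet_derivative_eq)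
    (use assms bounded_linear.has_derivative frechet_derivative_works in blast)

lemma frechet_derivative_bilinear:
  assumes "bounded_bilinear B" "f differentiable (at p)" "g differentiable (at p)"
  shows "frechet_derivative (\<lambda>q. B (f q) (g q)) (at p) =
    (\<lambda>w. B (f p) (frechet_derivative g (at p) w) + B (frechet_derivative f (at p) w) (g p))"
  by (rule frechet_derivative_eq, rule bounded_bilinear.FDERIV[OF assms(1)])
    (use assms frechet_derivative_works in blast)+

lemma frechet_derivative_add:
  assumes "f differentiable (at p)" "g differentiable (at p)"
  shows "frechet_derivative (\<lambda>q. f q + g q) (at p) =
    (\<lambda>w. frechet_derivative f (at p) w + frechet_derivative g (at p) w)"
  by (rule frechet_derivative_eq, rule has_derivative_add)
    (use assms frechet_derivative_works in blast)+

section \<open>Closure properties of \<open>C^k\<close> and smooth maps on open sets\<close>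

lemma Ck_on_cong:
  assumes "open S"
  shows "(\<And>q. q \<in> S \<Longrightarrow> f q = g q) \<Longrightarrow> Ck_on k S f \<longleftrightarrow> Ck_on k S g"
proof (induction k arbitrary: f g)
  case 0
  then show ?case by (simp cong: continuous_on_cong)
next
  case (Suc k)
  have "f differentiable (at p) \<longleftrightarrow> g differentiable (at p)" if "p \<in> S" for p
    unfolding differentiable_def
    using has_derivative_transform_within_open[OF _ \<open>open S\<close> that] Suc.prems by metis
  moreover have "Ck_on k S (\<lambda>p. frechet_derivative f (at p) w) \<longleftrightarrow>
      Ck_on k S (\<lambda>p. frechet_derivative g (at p) w)" for w
    by (rule Suc.IH) (metis frechet_derivative_cong_open[OF \<open>open S\<close>] Suc.prems)
  ultimately show ?case by simp
qed

lemma Ck_on_differentiable: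
  "Ck_on (Suc k) S f \<Longrightarrow> p \<in> S \<Longrightarrow> f differentiable (at p)"
  by simp

lemma Ck_on_Suc_D: "Ck_on (Suc k) S f \<Longrightarrow> Ck_on k S f"
proof (induction k arbitrary: f)
  case 0
  then have "f differentiable_on S"
    by (simp add: differentiable_at_imp_differentiable_on)
  then show ?case by (simp add: differentiable_imp_continuous_on)
next
  case (Suc k)
  have "Ck_on k S (\<lambda>p. frechet_derivative f (at p) w)" for w
    using Suc.prems by (intro Suc.IH) (rule Ck_on.simps(2)[THEN iffD1, THEN conjunct2, rule_format])
  moreover have "f differentiable (at p)" if "p \<in> S" for p
    using Ck_on_differentiable[OF Suc.prems that] .
  ultimately show ?case by simp
qed

lemma Ck_on_const: "Ck_on k S (\<lambda>_. c)"
  by (induction k arbitrary: c) auto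

lemma Ck_on_bounded_linear:
  assumes "bounded_linear L" shows "Ck_on k S L"
proof (cases k)
  case 0
  then show ?thesis
    using assms linear_continuous_on by auto
next
  case (Suc m)
  have L: "(L has_derivative L) (at p)" for p
    by (rule bounded_linear_imp_has_derivative[OF assms])
  have d: "frechet_derivative L (at p) = L" for p
    by (rule frechet_derivative_eq[OF L])
  have "Ck_on m S (\<lambda>p. frechet_derivative L (at p) w)" for w
    unfolding d by (rule Ck_on_const)
  moreover have "L differentiable (at p)" for p
    by (rule differentiableI[OF L])
  ultimately show ?thesis
    unfolding Suc Ck_on.simps by blast
qed

lemma Ck_on_bounded_linear_compose:
  assumes "open S" "bounded_linear L"
  shows "Ck_on k S f \<Longrightarrow> Ck_on k S (\<lambda>p. L (f p))"
proof (induction k arbitrary: f)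
  case 0
  then show ?case by (simp add: bounded_linear.continuous_on[OF assms(2)])
next
  case (Suc k)
  have "Ck_on k S (\<lambda>p. frechet_derivative (\<lambda>p. L (f p)) (at p) w)" for w
    using Suc by (subst Ck_on_cong[OF \<open>open S\<close>, where g = "\<lambda>p. L (frechet_derivative f (at p) w)"])
      (simp_all add: frechet_derivative_bounded_linear_compose[OF assms(2)])
  then show ?case
    using Suc.prems differentiable_bounded_linear_compose[OF assms(2)] unfolding Ck_on.simps by blast
qed

lemma Ck_on_add:
  assumes "open S"
  shows "Ck_on k S f \<Longrightarrow> Ck_on k S g \<Longrightarrow> Ck_on k S (\<lambda>p. f p + g p)"
proof (induction k arbitrary: f g)
  case 0
  then show ?case by (simp add: continuous_on_add)
next
  case (Suc k)
  have "Ck_on k S (\<lambda>p. frechet_derivative (\<lambda>p. f p + g p) (at p) w)" for w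
    using Suc by (subst Ck_on_cong[OF \<open>open S\<close>,
          where g = "\<lambda>p. frechet_derivative f (at p) w + frechet_derivative g (at p) w"])
      (simp_all add: frechet_derivative_add)
  then show ?case using Suc.prems by simp
qed

text \<open>By the Leibniz rule each directional derivative is a sum of two products of the same
  bilinear kind. In each product one factor is undifferentiated, and \<open>Ck_on_Suc_D\<close>
  lowers its order to that of the other.\<close>

lemma Ck_on_bilinear:
  assumes "open S" "bounded_bilinear B"
  shows "Ck_on k S f \<Longrightarrow> Ck_on k S g \<Longrightarrow> Ck_on k S (\<lambda>p. B (f p) (g p))"
proof (induction k arbitrary: f g)
  case 0
  then show ?case by (simp add: bounded_bilinear.continuous_on[OF assms(2)])
next
  case (Suc k)
  have "Ck_on k S (\<lambda>p. frechet_derivative (\<lambda>p. B (f p) (g p)) (at p) w)" for w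
  proof (subst Ck_on_cong[OF \<open>open S\<close>, where g = "\<lambda>p. B (f p) (frechet_derivative g (at p) w)
      + B (frechet_derivative f (at p) w) (g p)"])
    show "Ck_on k S (\<lambda>p. B (f p) (frechet_derivative g (at p) w)
        + B (frechet_derivative f (at p) w) (g p))"
      using Suc.prems Suc.prems[THEN Ck_on_Suc_D]
      by (intro Ck_on_add[OF \<open>open S\<close>] Suc.IH) auto
  qed (use Suc.prems in \<open>simp add: frechet_derivative_bilinear[OF assms(2)]\<close>)
  then show ?case
    using Suc.prems differentiable_bilinear[OF assms(2)] unfolding Ck_on.simps by blast
qed

lemma smooth_on_cong:
  "open S \<Longrightarrow> (\<And>q. q \<in> S \<Longrightarrow> f q = g q) \<Longrightarrow> smooth_on S f \<longleftrightarrow> smooth_on S g"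
  unfolding smooth_on_def using Ck_on_cong by metis

lemma smooth_on_imp_Ck_on: "smooth_on S f \<Longrightarrow> Ck_on k S f"
  by (simp add: smooth_on_def)

lemma smooth_on_differentiable: "smooth_on S f \<Longrightarrow> p \<in> S \<Longrightarrow> f differentiable (at p)"
  by (metis Ck_on_differentiable smooth_on_def)

lemma smooth_on_continuous_on: "smooth_on S f \<Longrightarrow> continuous_on S f"
  by (metis Ck_on.simps(1) smooth_on_def)

lemma smooth_on_frechet_derivative:
  "smooth_on S f \<Longrightarrow> smooth_on S (\<lambda>p. frechet_derivative f (at p) w)"
  unfolding smooth_on_def by (metis Ck_on.simps(2))

lemma smooth_on_const: "smooth_on S (\<lambda>_. c)"
  by (simp add: smooth_on_def Ck_on_const)

lemma smooth_on_bounded_linear: "bounded_linear L \<Longrightarrow> smooth_on S L"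
  by (simp add: smooth_on_def Ck_on_bounded_linear)

lemma smooth_on_bounded_linear_compose:
  "open S \<Longrightarrow> bounded_linear L \<Longrightarrow> smooth_on S f \<Longrightarrow> smooth_on S (\<lambda>p. L (f p))"
  by (simp add: smooth_on_def Ck_on_bounded_linear_compose)

lemma smooth_on_add:
  "open S \<Longrightarrow> smooth_on S f \<Longrightarrow> smooth_on S g \<Longrightarrow> smooth_on S (\<lambda>p. f p + g p)"
  by (simp add: smooth_on_def Ck_on_add)

lemma smooth_on_mult:
  fixes f g :: "'a::real_normed_vector \<Rightarrow> 'b::real_normed_algebra"
  shows "open S \<Longrightarrow> smooth_on S f \<Longrightarrow> smooth_on S g \<Longrightarrow> smooth_on S (\<lambda>p. f p * g p)"
  by (simp add: smooth_on_def Ck_on_bilinear[OF _ bounded_bilinear_mult])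

section \<open>Symmetry of second derivatives\<close>

lemma has_real_derivative_along_line:
  fixes f :: "'a::real_normed_vector \<Rightarrow> real"
  assumes "f differentiable (at (p + a *\<^sub>R v))"
  shows "((\<lambda>s. f (p + s *\<^sub>R v)) has_real_derivative frechet_derivative f (at (p + a *\<^sub>R v)) v) (at a)"
proof -
  let ?D = "frechet_derivative f (at (p + a *\<^sub>R v))"
  have D: "(f has_derivative ?D) (at (p + a *\<^sub>R v))"
    using assms frechet_derivative_works by blast
  have "((\<lambda>s. p + s *\<^sub>R v) has_derivative (\<lambda>s. s *\<^sub>R v)) (at a)"
    by (auto intro!: derivative_eq_intros)
  from has_derivative_compose[OF this D] show ?thesis
    using linear_scale[OF has_derivative_linear[OF D]]
    by (simp add: has_field_derivative_def mult_commute_abs)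
qed

text \<open>The second difference is symmetric in \<open>v\<close> and \<open>w\<close>; dividing by \<open>r\<^sup>2\<close> and letting \<open>r\<close> tend to \<open>0\<close>
  gives the symmetry of second derivatives.\<close>

lemma second_difference:
  fixes f :: "'a::real_normed_vector \<Rightarrow> real"
  assumes "Ck_on 2 S f" "r > 0"
    and S: "\<And>a b. 0 \<le> a \<Longrightarrow> a \<le> r \<Longrightarrow> 0 \<le> b \<Longrightarrow> b \<le> r \<Longrightarrow> p + a *\<^sub>R v + b *\<^sub>R w \<in> S"
  obtains a b where "0 < a" "a < r" "0 < b" "b < r"
    "f (p + r *\<^sub>R v + r *\<^sub>R w) - f (p + r *\<^sub>R v) - f (p + r *\<^sub>R w) + f p =
      r\<^sup>2 * frechet_derivative (\<lambda>q. frechet_derivative f (at q) v) (at (p + a *\<^sub>R v + b *\<^sub>R w)) w"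
proof -
  have d1: "f differentiable (at q)" and
    d2: "(\<lambda>q. frechet_derivative f (at q) v) differentiable (at q)" if "q \<in> S" for q
    using assms(1) that by (simp_all add: numeral_2_eq_2)
  \<comment> \<open>The second difference is \<open>g r - g 0\<close>. The mean value theorem in the
    direction \<open>v\<close> turns it into \<open>r * g' a\<close>, and a second application, in
    the direction \<open>w\<close>, handles \<open>g' a = h r - h 0\<close>.\<close>
  define g where "g a = f (p + a *\<^sub>R v + r *\<^sub>R w) - f (p + a *\<^sub>R v)" for a
  define g' where "g' a = frechet_derivative f (at (p + a *\<^sub>R v + r *\<^sub>R w)) v
      - frechet_derivative f (at (p + a *\<^sub>R v)) v" for a
  have g: "(g has_real_derivative g' a) (at a)" if "0 \<le> a" "a \<le> r" for a
  proof -
    have *: "p + r *\<^sub>R w + a *\<^sub>R v = p + a *\<^sub>R v + r *\<^sub>R w" for a by (simp add: algebra_simps)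
    have "((\<lambda>s. f (p + r *\<^sub>R w + s *\<^sub>R v)) has_real_derivative
        frechet_derivative f (at (p + r *\<^sub>R w + a *\<^sub>R v)) v) (at a)"
      using S[of a r] that \<open>r > 0\<close> by (intro has_real_derivative_along_line d1) (simp add: *)
    moreover have "((\<lambda>s. f (p + s *\<^sub>R v)) has_real_derivative
        frechet_derivative f (at (p + a *\<^sub>R v)) v) (at a)"
      using S[of a 0] that \<open>r > 0\<close> by (intro has_real_derivative_along_line d1) simp
    ultimately show ?thesis
      unfolding g_def g'_def * by (rule DERIV_diff)
  qed
  obtain a where a: "0 < a" "a < r" "g r - g 0 = (r - 0) * g' a"
    using MVT2[OF \<open>r > 0\<close>, of g g'] g by auto
  define h where "h b = frechet_derivative f (at (p + a *\<^sub>R v + b *\<^sub>R w)) v" for b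
  define h' where "h' b = frechet_derivative (\<lambda>q. frechet_derivative f (at q) v)
      (at (p + a *\<^sub>R v + b *\<^sub>R w)) w" for b
  have "(h has_real_derivative h' b) (at b)" if "0 \<le> b" "b \<le> r" for b
    unfolding h_def h'_def
    using S[of a b] a that by (intro has_real_derivative_along_line d2) auto
  then obtain b where b: "0 < b" "b < r" "h r - h 0 = (r - 0) * h' b"
    using MVT2[OF \<open>r > 0\<close>, of h h'] by auto
  have "g' a = h r - h 0" by (simp add: g'_def h_def)
  with a b have "g r - g 0 = r\<^sup>2 * h' b" by (simp add: power2_eq_square)
  then show ?thesis
    using that[OF a(1,2) b(1,2)] by (simp add: g_def h'_def algebra_simps)
qed

lemma frechet_derivative_commute:
  fixes f :: "'a::real_normed_vector \<Rightarrow> real"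
  assumes "open S" "Ck_on 2 S f" "p \<in> S"
  shows "frechet_derivative (\<lambda>q. frechet_derivative f (at q) v) (at p) w =
    frechet_derivative (\<lambda>q. frechet_derivative f (at q) w) (at p) v" (is "?A v w p = ?A w v p")
proof (rule ccontr)
  assume neq: "?A v w p \<noteq> ?A w v p"
  \<comment> \<open>Half the supposed gap: near \<open>p\<close> each mixed derivative stays within
    \<open>e\<close> of its value at \<open>p\<close>, so the two cannot take a common value
    there.\<close>
  define e where "e = \<bar>?A v w p - ?A w v p\<bar> / 2"
  have "e > 0" using neq by (simp add: e_def)
  have lim: "(?A v w \<longlongrightarrow> ?A v w p) (nhds p)" for v w
  proof -
    have "continuous_on S (?A v w)"
      using assms(2) by (simp add: numeral_2_eq_2)
    then have "isCont (?A v w) p"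
      by (rule continuous_on_interior) (simp add: interior_open[OF \<open>open S\<close>] \<open>p \<in> S\<close>)
    then show ?thesis
      unfolding isCont_def by (rule tendsto_at_iff_tendsto_nhds[of "?A v w", THEN iffD1])
  qed
  have "eventually (\<lambda>q. q \<in> S \<and> dist (?A v w q) (?A v w p) < e \<and> dist (?A w v q) (?A w v p) < e) (nhds p)"
    using lim \<open>e > 0\<close> assms(1,3)
    by (intro eventually_conj eventually_nhds_in_open tendstoD) auto
  then obtain d where d: "d > 0" "\<And>q. dist q p < d \<Longrightarrow>
      q \<in> S \<and> dist (?A v w q) (?A v w p) < e \<and> dist (?A w v q) (?A w v p) < e"
    by (auto simp: eventually_nhds_metric)
  \<comment> \<open>With this choice the whole parallelogram spanned by \<open>r *\<^sub>R v\<close>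
    and \<open>r *\<^sub>R w\<close> lies in the ball of radius \<open>d\<close>; the summand 1
    covers \<open>v = w = 0\<close>.\<close>
  define r where "r = d / (norm v + norm w + 1)"
  have n: "norm v + norm w + 1 > 0" by (simp add: add_nonneg_pos)
  have "r > 0" using d n by (simp add: r_def)
  have near: "dist (p + a *\<^sub>R v + b *\<^sub>R w) p < d" if "0 \<le> a" "a \<le> r" "0 \<le> b" "b \<le> r" for a b
  proof -
    have "dist (p + a *\<^sub>R v + b *\<^sub>R w) p = norm (a *\<^sub>R v + b *\<^sub>R w)"
      by (simp add: dist_norm add.assoc)
    also have "\<dots> \<le> norm (a *\<^sub>R v) + norm (b *\<^sub>R w)"
      by (rule norm_triangle_ineq)
    also have "\<dots> \<le> r * norm v + r * norm w"
      using that by (intro add_mono) (auto intro: mult_right_mono)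
    also have "\<dots> < r * (norm v + norm w + 1)" using \<open>r > 0\<close> by (simp add: algebra_simps)
    also have "\<dots> = d" using n by (simp add: r_def)
    finally show ?thesis .
  qed
  have swap: "p + a *\<^sub>R w + b *\<^sub>R v = p + b *\<^sub>R v + a *\<^sub>R w" for a b by (simp add: algebra_simps)
  obtain a b where ab: "0 < a" "a < r" "0 < b" "b < r"
    "f (p + r *\<^sub>R v + r *\<^sub>R w) - f (p + r *\<^sub>R v) - f (p + r *\<^sub>R w) + f p =
      r\<^sup>2 * ?A v w (p + a *\<^sub>R v + b *\<^sub>R w)"
    by (rule second_difference[OF assms(2) \<open>r > 0\<close> near[THEN d(2), THEN conjunct1]])
  have inS: "p + a *\<^sub>R w + b *\<^sub>R v \<in> S" if "0 \<le> a" "a \<le> r" "0 \<le> b" "b \<le> r" for a b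
    using near[of b a] d(2) that by (simp add: swap)
  obtain a' b' where ab': "0 < a'" "a' < r" "0 < b'" "b' < r"
    "f (p + r *\<^sub>R w + r *\<^sub>R v) - f (p + r *\<^sub>R w) - f (p + r *\<^sub>R v) + f p =
      r\<^sup>2 * ?A w v (p + a' *\<^sub>R w + b' *\<^sub>R v)"
    by (rule second_difference[OF assms(2) \<open>r > 0\<close> inS])
  have "r\<^sup>2 * ?A v w (p + a *\<^sub>R v + b *\<^sub>R w) = r\<^sup>2 * ?A w v (p + b' *\<^sub>R v + a' *\<^sub>R w)"
    using ab(5) ab'(5)[unfolded swap] by linarith
  then have "?A v w (p + a *\<^sub>R v + b *\<^sub>R w) = ?A w v (p + b' *\<^sub>R v + a' *\<^sub>R w)"
    using \<open>r > 0\<close> by simp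
  moreover have "dist (?A v w (p + a *\<^sub>R v + b *\<^sub>R w)) (?A v w p) < e"
    using d(2)[OF near[of a b]] ab by simp
  moreover have "dist (?A w v (p + b' *\<^sub>R v + a' *\<^sub>R w)) (?A w v p) < e"
    using d(2)[OF near[of b' a']] ab' by simp
  ultimately have "\<bar>?A v w p - ?A w v p\<bar> < 2 * e"
    unfolding dist_real_def by linarith
  then show False by (simp add: e_def)
qed

text \<open>The real case applies to every coordinate \<open>f q \<bullet> b\<close>, because taking
  a coordinate is linear and commutes with both differentiations.\<close>

lemma frechet_derivative_commute_euclidean:
  fixes f :: "'a::real_normed_vector \<Rightarrow> 'b::euclidean_space"
  assumes "open S" "smooth_on S f" "p \<in> S"
  shows "frechet_derivative (\<lambda>q. frechet_derivative f (at q) v) (at p) w =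
    frechet_derivative (\<lambda>q. frechet_derivative f (at q) w) (at p) v"
proof (rule euclidean_eqI)
  fix b :: 'b assume "b \<in> Basis"
  have inner: "frechet_derivative (\<lambda>q. g q \<bullet> b) (at q) u = frechet_derivative g (at q) u \<bullet> b"
    if "smooth_on S g" "q \<in> S" for g q u
    by (rule fun_cong[OF frechet_derivative_bounded_linear_compose[OF bounded_linear_inner_left
          smooth_on_differentiable[OF that]]])
  have inner2: "frechet_derivative (\<lambda>q. frechet_derivative (\<lambda>q. f q \<bullet> b) (at q) v) (at p) w =
      frechet_derivative (\<lambda>q. frechet_derivative f (at q) v) (at p) w \<bullet> b" for v w
  proof -
    have "frechet_derivative (\<lambda>q. frechet_derivative (\<lambda>q. f q \<bullet> b) (at q) v) (at p) =
        frechet_derivative (\<lambda>q. frechet_derivative f (at q) v \<bullet> b) (at p)"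
      by (rule frechet_derivative_cong_open[OF assms(1,3)]) (rule inner[OF assms(2)])
    then show ?thesis
      using inner[OF smooth_on_frechet_derivative[OF assms(2)] assms(3)] by simp
  qed
  have "smooth_on S (\<lambda>q. f q \<bullet> b)"
    by (rule smooth_on_bounded_linear_compose[OF assms(1) bounded_linear_inner_left assms(2)])
  from frechet_derivative_commute[OF assms(1) smooth_on_imp_Ck_on[OF this] assms(3)]
  show "frechet_derivative (\<lambda>q. frechet_derivative f (at q) v) (at p) w \<bullet> b =
      frechet_derivative (\<lambda>q. frechet_derivative f (at q) w) (at p) v \<bullet> b"
    unfolding inner2 .
qed

section \<open>The left-invariant frame\<close>

abbreviation opT :: "(heis \<Rightarrow> 'b::real_normed_vector) \<Rightarrow> heis \<Rightarrow> 'b" where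
  "opT \<equiv> deriv_along fieldT"

lemma deriv_along_cong:
  "open \<Omega> \<Longrightarrow> p \<in> \<Omega> \<Longrightarrow> (\<And>q. q \<in> \<Omega> \<Longrightarrow> f q = g q) \<Longrightarrow> deriv_along W f p = deriv_along W g p"
  unfolding deriv_along_def using frechet_derivative_cong_open[of \<Omega> p f g] by simp

lemma deriv_along_eq: "(f has_derivative D) (at p) \<Longrightarrow> deriv_along W f p = D (W p)"
  by (simp add: deriv_along_def frechet_derivative_eq)

lemma deriv_along_cmult:
  fixes f :: "heis \<Rightarrow> real"
  assumes "f differentiable (at p)"
  shows "deriv_along W (\<lambda>q. c * f q) p = c * deriv_along W f p"
  unfolding deriv_along_def
  by (simp add: frechet_derivative_bounded_linear_compose[OF bounded_linear_mult_right assms])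

lemma bounded_linear_Re_fst: "bounded_linear (\<lambda>p::heis. Re (fst p))"
  by (rule bounded_linear_compose[OF bounded_linear_Re bounded_linear_fst])

lemma bounded_linear_Im_fst: "bounded_linear (\<lambda>p::heis. Im (fst p))"
  by (rule bounded_linear_compose[OF bounded_linear_Im bounded_linear_fst])

lemma frechet_derivative_add_scaleR:
  assumes "f differentiable (at p)"
  shows "frechet_derivative f (at p) (v + c *\<^sub>R w) =
    frechet_derivative f (at p) v + c *\<^sub>R frechet_derivative f (at p) w"
  using has_derivative_linear[OF frechet_derivative_works[THEN iffD1, OF assms]]
  by (simp add: linear_add linear_scale)

lemma opX_eq_partials:
  assumes "f differentiable (at p)"
  shows "opX f p = frechet_derivative f (at p) (1, 0)
    + (2 * Im (fst p)) *\<^sub>R frechet_derivative f (at p) (0, 1)"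
  unfolding deriv_along_def fieldX_def by (rule frechet_derivative_add_scaleR[OF assms])

lemma opY_eq_partials:
  assumes "f differentiable (at p)"
  shows "opY f p = frechet_derivative f (at p) (\<i>, 0)
    + (- 2 * Re (fst p)) *\<^sub>R frechet_derivative f (at p) (0, 1)"
  using frechet_derivative_add_scaleR[OF assms, of "(\<i>, 0)" "- 2 * Re (fst p)" "(0, 1)"]
  by (simp add: deriv_along_def fieldY_def)

lemma opT_eq_partial: "opT f = (\<lambda>p. frechet_derivative f (at p) (0, 1))"
  by (simp add: deriv_along_def fieldT_def fun_eq_iff)

text \<open>The forms \<open>dx\<close>, \<open>dy\<close>, \<theta> are the dual frame of
  \<open>X\<close>, \<open>Y\<close>, \<open>T\<close>, so
  \<open>W = dx(W) X + dy(W) Y + \<theta>(W) T\<close>.\<close>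

lemma deriv_along_partials:
  fixes f :: "heis \<Rightarrow> real"
  assumes "f differentiable (at p)"
  shows "deriv_along W f p = Re (fst (W p)) * opX f p + Im (fst (W p)) * opY f p
    + contact_form p (W p) * opT f p"
proof -
  let ?D = "frechet_derivative f (at p)"
  have lin: "linear ?D"
    using has_derivative_linear[OF frechet_derivative_works[THEN iffD1, OF assms]] .
  obtain a b c where W: "W p = (Complex a b, c)" by (metis complex.exhaust surj_pair)
  have "W p = a *\<^sub>R (1, 0) + b *\<^sub>R (\<i>, 0) + c *\<^sub>R (0, 1)"
    by (simp add: W complex_eq_iff)
  then have "?D (W p) = a * ?D (1, 0) + b * ?D (\<i>, 0) + c * ?D (0, 1)"
    by (simp only: linear_add[OF lin] linear_scale[OF lin] real_scaleR_def)
  moreover have "deriv_along W f p = ?D (W p)" by (simp add: deriv_along_def)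
  ultimately show ?thesis
    by (simp add: opX_eq_partials[OF assms] opY_eq_partials[OF assms] opT_eq_partial
        W contact_form_def algebra_simps)
qed

context
  fixes \<Omega> :: "heis set" and f :: "heis \<Rightarrow> real"
  assumes \<Omega>: "open \<Omega>" and f: "smooth_on \<Omega> f"
begin

lemma smooth_on_opT: "smooth_on \<Omega> (opT f)"
  unfolding opT_eq_partial by (rule smooth_on_frechet_derivative[OF f])

lemma smooth_on_opX: "smooth_on \<Omega> (opX f)"
proof -
  have "smooth_on \<Omega> (\<lambda>p. frechet_derivative f (at p) (1, 0)
      + (2 * Im (fst p)) * frechet_derivative f (at p) (0, 1))"
    by (intro smooth_on_add smooth_on_mult \<Omega> smooth_on_frechet_derivative f smooth_on_const
        smooth_on_bounded_linear bounded_linear_Im_fst)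
  then show ?thesis
    by (rule smooth_on_cong[OF \<Omega>, THEN iffD1, rotated])
      (use opX_eq_partials[OF smooth_on_differentiable[OF f]] in simp)
qed

lemma smooth_on_opY: "smooth_on \<Omega> (opY f)"
proof -
  have "smooth_on \<Omega> (\<lambda>p. frechet_derivative f (at p) (\<i>, 0)
      + (- 2 * Re (fst p)) * frechet_derivative f (at p) (0, 1))"
    by (intro smooth_on_add smooth_on_mult \<Omega> smooth_on_frechet_derivative f smooth_on_const
        smooth_on_bounded_linear bounded_linear_Re_fst)
  then show ?thesis
    by (rule smooth_on_cong[OF \<Omega>, THEN iffD1, rotated])
      (use opY_eq_partials[OF smooth_on_differentiable[OF f]] in simp)
qed

text \<open>\<open>X\<close> and \<open>Y\<close> are both a constant direction plus a linear
  coefficient times a constant direction. As \<open>L\<close> is its own derivative, the product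
  rule leaves the last, first-order term, the source of the bracket.\<close>

lemma frechet_derivative_coeff_field:
  assumes p: "p \<in> \<Omega>" and L: "bounded_linear L"
  shows "frechet_derivative (\<lambda>q. frechet_derivative f (at q) a + L q * frechet_derivative f (at q) b)
      (at p) w =
    frechet_derivative (\<lambda>q. frechet_derivative f (at q) a) (at p) w
    + L p * frechet_derivative (\<lambda>q. frechet_derivative f (at q) b) (at p) w
    + L w * frechet_derivative f (at p) b"
proof -
  have d: "(\<lambda>q. frechet_derivative f (at q) v) differentiable (at p)" for v
    using smooth_on_differentiable[OF smooth_on_frechet_derivative[OF f] p] .
  have L': "L differentiable (at p)" "frechet_derivative L (at p) = L"
    by (rule differentiableI frechet_derivative_eq, rule bounded_linear_imp_has_derivative[OF L])+
  have m: "(\<lambda>q. L q * frechet_derivative f (at q) b) differentiable (at p)"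
    by (intro differentiable_mult L' d)
  show ?thesis
    by (simp add: frechet_derivative_add[OF d m]
        frechet_derivative_bilinear[OF bounded_bilinear_mult L'(1) d] L'(2))
qed

text \<open>Symmetry cancels all second derivatives, and only derivatives of the coefficients
  survive: \<open>X(-2x) - Y(2y) = -4\<close> for the first identity. The coefficients do not depend
  on \<open>t\<close>, so nothing survives in the other two.\<close>

lemma
  assumes p: "p \<in> \<Omega>"
  shows opX_opY_commutator: "opX (opY f) p = opY (opX f) p - 4 * opT f p"
    and opX_opT_commute: "opX (opT f) p = opT (opX f) p"
    and opY_opT_commute: "opY (opT f) p = opT (opY f) p"
proof -
  define D where "D v w = frechet_derivative (\<lambda>q. frechet_derivative f (at q) v) (at p) w" for v w
  have sym: "D v w = D w v" for v w
    unfolding D_def by (rule frechet_derivative_commute[OF \<Omega> smooth_on_imp_Ck_on[OF f] p])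
  have X: "opX g p = frechet_derivative g (at p) (1, 0)
      + (2 * Im (fst p)) * frechet_derivative g (at p) (0, 1)" if "smooth_on \<Omega> g" for g :: "heis \<Rightarrow> real"
    using opX_eq_partials[OF smooth_on_differentiable[OF that p]] by simp
  have Y: "opY g p = frechet_derivative g (at p) (\<i>, 0)
      + (- 2 * Re (fst p)) * frechet_derivative g (at p) (0, 1)" if "smooth_on \<Omega> g" for g :: "heis \<Rightarrow> real"
    using opY_eq_partials[OF smooth_on_differentiable[OF that p]] by simp
  have "frechet_derivative (opX f) (at p) = frechet_derivative (\<lambda>q. frechet_derivative f (at q) (1, 0)
      + (2 * Im (fst q)) * frechet_derivative f (at q) (0, 1)) (at p)"
    by (rule frechet_derivative_cong_open[OF \<Omega> p])
      (use opX_eq_partials[OF smooth_on_differentiable[OF f]] in simp)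
  then have DX: "frechet_derivative (opX f) (at p) w =
      D (1, 0) w + 2 * Im (fst p) * D (0, 1) w + 2 * Im (fst w) * frechet_derivative f (at p) (0, 1)" for w
    using frechet_derivative_coeff_field[OF p bounded_linear_const_mult[OF bounded_linear_Im_fst],
        of "(1, 0)" "2" "(0, 1)" w]
    by (simp add: D_def)
  have "frechet_derivative (opY f) (at p) = frechet_derivative (\<lambda>q. frechet_derivative f (at q) (\<i>, 0)
      + (- 2 * Re (fst q)) * frechet_derivative f (at q) (0, 1)) (at p)"
    by (rule frechet_derivative_cong_open[OF \<Omega> p])
      (use opY_eq_partials[OF smooth_on_differentiable[OF f]] in simp)
  then have DY: "frechet_derivative (opY f) (at p) w =
      D (\<i>, 0) w + - 2 * Re (fst p) * D (0, 1) w + - 2 * Re (fst w) * frechet_derivative f (at p) (0, 1)" for w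
    using frechet_derivative_coeff_field[OF p bounded_linear_const_mult[OF bounded_linear_Re_fst],
        of "(\<i>, 0)" "- 2" "(0, 1)" w]
    by (simp add: D_def)
  have DT: "frechet_derivative (opT f) (at p) w = D (0, 1) w" for w
    by (simp add: opT_eq_partial D_def)
  note XYT = X[OF smooth_on_opX] X[OF smooth_on_opY] X[OF smooth_on_opT]
    Y[OF smooth_on_opX] Y[OF smooth_on_opY] Y[OF smooth_on_opT]
  note [simp] = sym[of "(\<i>, 0)" "(1, 0)"] sym[of "(0, 1)" "(1, 0)"] sym[of "(0, 1)" "(\<i>, 0)"]
  show "opX (opY f) p = opY (opX f) p - 4 * opT f p"
    by (simp add: XYT DX DY opT_eq_partial algebra_simps)
  show "opX (opT f) p = opT (opX f) p" "opY (opT f) p = opT (opY f) p"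
    by (simp_all add: XYT DT, simp_all add: opT_eq_partial DX DY)
qed

end

section \<open>The differential equation for the potential\<close>

text \<open>Here \<open>a\<close>, \<open>b\<close>, \<open>c\<close> are the coordinate partials;
  along the frame they give \<open>X g = a + 2 y c\<close>, \<open>Y g = b - 2 x c\<close> and
  \<open>T g = c\<close>.\<close>

abbreviation has_partials :: "(heis \<Rightarrow> real) \<Rightarrow> real \<Rightarrow> real \<Rightarrow> real \<Rightarrow> heis \<Rightarrow> bool" where
  "has_partials g a b c p \<equiv>
    (g has_derivative (\<lambda>w. Re (fst w) * a + Im (fst w) * b + snd w * c)) (at p)"

text \<open>The frame derivatives of \<open>f\<close> and \<open>g\<close> agree and the frame
  spans, so \<open>f - g\<close> has zero differential, hence is constant on the connected set. Each
  use integrates one unknown and yields one real constant.\<close>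

lemma partials_integrate:
  fixes f g :: "heis \<Rightarrow> real"
  assumes "open \<Omega>" "connected \<Omega>" "smooth_on \<Omega> f"
    and "\<And>p. p \<in> \<Omega> \<Longrightarrow> has_partials g (a p) (b p) (c p) p"
    and "\<And>p. p \<in> \<Omega> \<Longrightarrow> opX f p = a p + 2 * Im (fst p) * c p"
    and "\<And>p. p \<in> \<Omega> \<Longrightarrow> opY f p = b p - 2 * Re (fst p) * c p"
    and "\<And>p. p \<in> \<Omega> \<Longrightarrow> opT f p = c p"
  obtains d where "\<And>p. p \<in> \<Omega> \<Longrightarrow> f p = g p + d"
proof -
  have der: "((\<lambda>q. f q - g q) has_derivative (\<lambda>w. 0)) (at p within \<Omega>)" if p: "p \<in> \<Omega>" for p
  proof -
    have "frechet_derivative f (at p) w = Re (fst w) * a p + Im (fst w) * b p + snd w * c p" for w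
      using deriv_along_partials[OF smooth_on_differentiable[OF assms(3) p], of "\<lambda>_. w"] assms(5-7)[OF p]
      by (simp add: deriv_along_def[of "\<lambda>_. w"] contact_form_def algebra_simps)
    then have "(f has_derivative (\<lambda>w. Re (fst w) * a p + Im (fst w) * b p + snd w * c p)) (at p)"
      using frechet_derivative_works[THEN iffD1, OF smooth_on_differentiable[OF assms(3) p]] by presburger
    from has_derivative_diff[OF this assms(4)[OF p]]
    have "((\<lambda>q. f q - g q) has_derivative (\<lambda>w. 0)) (at p)" by simp
    then show ?thesis by (rule has_derivative_at_withinI)
  qed
  have "(\<lambda>q. f q - g q) constant_on \<Omega>"
    by (rule has_derivative_zero_connected_constant_on[OF assms(2,1) finite.emptyI])
      (use der has_derivative_continuous_on[OF der] in blast)+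
  then obtain d where "\<And>p. p \<in> \<Omega> \<Longrightarrow> f p - g p = d" unfolding constant_on_def by blast
  then have "f p = g p + d" if "p \<in> \<Omega>" for p using that by (metis add.commute diff_eq_eq)
  then show ?thesis by (rule that)
qed

lemma
  fixes f g :: "heis \<Rightarrow> real"
  assumes "open \<Omega>" "p \<in> \<Omega>" "\<And>q. q \<in> \<Omega> \<Longrightarrow> f q = g q" "has_partials g a b c p"
  shows opX_eq_if_partials: "opX f p = a + 2 * Im (fst p) * c"
    and opY_eq_if_partials: "opY f p = b - 2 * Re (fst p) * c"
  using deriv_along_eq[OF assms(4)]
  by (simp_all add: deriv_along_cong[OF assms(1-3)] fieldX_def fieldY_def)

section \<open>The eight-parameter family of explicit solutions\<close>

definition polyU :: "real \<Rightarrow> real \<Rightarrow> real \<Rightarrow> real \<Rightarrow> real \<Rightarrow> real \<Rightarrow> real \<Rightarrow> real \<Rightarrow> real \<Rightarrow> real \<Rightarrow> real \<Rightarrow> real" where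
  "polyU c1 c2 c3 c4 c5 c6 c7 c8 x y t =
    c1 * (x^4 + 2 * x^2 * y^2 + y^4 + t^2) + c2 * (t * y - x * y^2 - x^3)
    + c3 * (t * x + x^2 * y + y^3) + c4 * (x^2 + y^2) + c5 * x + c6 * y + c7 * t + c8"

text \<open>\<open>polyXU\<close> and \<open>polyYU\<close> are the derivatives of \<open>polyU\<close> along \<open>X\<close> and \<open>Y\<close>.\<close>

definition polyXU :: "real \<Rightarrow> real \<Rightarrow> real \<Rightarrow> real \<Rightarrow> real \<Rightarrow> real \<Rightarrow> real \<Rightarrow> real \<Rightarrow> real \<Rightarrow> real" where
  "polyXU c1 c2 c3 c4 c5 c7 x y t =
    4 * c1 * (x^3 + x * y^2 + y * t) + c2 * (y^2 - 3 * x^2) + c3 * (t + 4 * x * y)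
    + 2 * c4 * x + 2 * c7 * y + c5"

definition polyYU :: "real \<Rightarrow> real \<Rightarrow> real \<Rightarrow> real \<Rightarrow> real \<Rightarrow> real \<Rightarrow> real \<Rightarrow> real \<Rightarrow> real \<Rightarrow> real" where
  "polyYU c1 c2 c3 c4 c6 c7 x y t =
    4 * c1 * (x^2 * y + y^3 - x * t) + c2 * (t - 4 * x * y) + c3 * (3 * y^2 - x^2)
    + 2 * c4 * y - 2 * c7 * x + c6"

lemma partials_polyU:
  fixes p :: heis
  defines "x \<equiv> Re (fst p)" and "y \<equiv> Im (fst p)" and "t \<equiv> snd p"
  shows "has_partials (\<lambda>p. polyU c1 c2 c3 c4 c5 c6 c7 c8 (Re (fst p)) (Im (fst p)) (snd p))
    (c1 * (4 * x^3 + 4 * x * y^2) + c2 * (- (y^2) - 3 * x^2) + c3 * (t + 2 * x * y) + 2 * c4 * x + c5)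
    (c1 * (4 * x^2 * y + 4 * y^3) + c2 * (t - 2 * x * y) + c3 * (x^2 + 3 * y^2) + 2 * c4 * y + c6)
    (2 * c1 * t + c2 * y + c3 * x + c7) p"
  unfolding polyU_def x_def y_def t_def
  by (auto intro!: derivative_eq_intros simp: fun_eq_iff algebra_simps power2_eq_square power3_eq_cube)

lemma partials_polyXU:
  fixes p :: heis
  defines "x \<equiv> Re (fst p)" and "y \<equiv> Im (fst p)" and "t \<equiv> snd p"
  shows "has_partials (\<lambda>p. polyXU c1 c2 c3 c4 c5 c7 (Re (fst p)) (Im (fst p)) (snd p))
    (4 * c1 * (3 * x^2 + y^2) - 6 * c2 * x + 4 * c3 * y + 2 * c4)
    (4 * c1 * (2 * x * y + t) + 2 * c2 * y + 4 * c3 * x + 2 * c7)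
    (4 * c1 * y + c3) p"
  unfolding polyXU_def x_def y_def t_def
  by (auto intro!: derivative_eq_intros simp: fun_eq_iff algebra_simps power2_eq_square power3_eq_cube)

lemma partials_polyYU:
  fixes p :: heis
  defines "x \<equiv> Re (fst p)" and "y \<equiv> Im (fst p)" and "t \<equiv> snd p"
  shows "has_partials (\<lambda>p. polyYU c1 c2 c3 c4 c6 c7 (Re (fst p)) (Im (fst p)) (snd p))
    (4 * c1 * (2 * x * y - t) - 4 * c2 * y - 2 * c3 * x - 2 * c7)
    (4 * c1 * (x^2 + 3 * y^2) - 4 * c2 * x + 6 * c3 * y + 2 * c4)
    (- 4 * c1 * x + c2) p"
  unfolding polyYU_def x_def y_def t_def
  by (auto intro!: derivative_eq_intros simp: fun_eq_iff algebra_simps power2_eq_square power3_eq_cube)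

lemma polyU_conformal:
  fixes u :: "heis \<Rightarrow> real"
  assumes "open \<Omega>" "p \<in> \<Omega>"
    and u: "\<And>q. q \<in> \<Omega> \<Longrightarrow> u q = polyU c1 c2 c3 c4 c5 c6 c7 c8 (Re (fst q)) (Im (fst q)) (snd q)"
  shows "opX (opX u) p = opY (opY u) p \<and> opX (opY u) p = - opY (opX u) p"
proof -
  note op = opX_eq_if_partials[OF assms(1)] opY_eq_if_partials[OF assms(1)]
  have X: "opX u q = polyXU c1 c2 c3 c4 c5 c7 (Re (fst q)) (Im (fst q)) (snd q)" if "q \<in> \<Omega>" for q
    using op(1)[OF that u partials_polyU] by (simp add: polyXU_def algebra_simps power2_eq_square)
  have Y: "opY u q = polyYU c1 c2 c3 c4 c6 c7 (Re (fst q)) (Im (fst q)) (snd q)" if "q \<in> \<Omega>" for q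
    using op(2)[OF that u partials_polyU] by (simp add: polyYU_def algebra_simps power2_eq_square)
  show ?thesis
    using op[OF assms(2) X partials_polyXU] op[OF assms(2) Y partials_polyYU]
    by (simp add: algebra_simps power2_eq_square)
qed

lemma deriv_along_cmult_on:
  fixes f g :: "heis \<Rightarrow> real"
  assumes "open \<Omega>" "p \<in> \<Omega>" "\<And>q. q \<in> \<Omega> \<Longrightarrow> f q = c * g q" "smooth_on \<Omega> g"
  shows "deriv_along W f p = c * deriv_along W g p"
  using deriv_along_cong[OF assms(1-3)] deriv_along_cmult[OF smooth_on_differentiable[OF assms(4,2)]]
  by simp

lemma deriv_along_zero_on:
  fixes f :: "heis \<Rightarrow> real"
  assumes "open \<Omega>" "p \<in> \<Omega>" "\<And>q. q \<in> \<Omega> \<Longrightarrow> f q = 0"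
  shows "deriv_along W f p = 0"
  using deriv_along_cong[OF assms(1,2), of f "\<lambda>_. 0" W] assms(3) by (simp add: deriv_along_def)

section \<open>Prolongation and integration of the overdetermined system\<close>

context
  fixes \<Omega> :: "heis set" and u :: "heis \<Rightarrow> real"
  assumes \<Omega>: "open \<Omega>" and u: "smooth_on \<Omega> u"
    and XX: "\<And>p. p \<in> \<Omega> \<Longrightarrow> opX (opX u) p = opY (opY u) p"
    and XY: "\<And>p. p \<in> \<Omega> \<Longrightarrow> opX (opY u) p = - opY (opX u) p"
begin

lemmas smooth_ops = smooth_on_opX[OF \<Omega>] smooth_on_opY[OF \<Omega>] smooth_on_opT[OF \<Omega>]
lemmas commutators = opX_opY_commutator[OF \<Omega>] opX_opT_commute[OF \<Omega>] opY_opT_commute[OF \<Omega>]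

text \<open>These identities close the system: every frame derivative of \<open>T^2 u\<close>,
  \<open>T X u\<close>, \<open>T Y u\<close>, \<open>T u\<close>, \<open>X^2 u\<close>,
  \<open>X u\<close>, \<open>Y u\<close> and \<open>u\<close> is zero or a multiple of one of these
  functions.\<close>

lemma pde_consequences:
  assumes p: "p \<in> \<Omega>"
  shows "opX (opY u) p = -2 * opT u p" "opY (opX u) p = 2 * opT u p"
    "opX (opX (opX u)) p = -6 * opT (opY u) p" "opY (opX (opX u)) p = 6 * opT (opX u) p"
    "opT (opX (opX u)) p = 0" "opT (opT (opX u)) p = 0" "opT (opT (opY u)) p = 0"
    "opT (opT (opT u)) p = 0"
proof -
  note smooth = smooth_ops u
  note cmult = deriv_along_cmult_on[OF \<Omega>] and cong = deriv_along_cong[OF \<Omega>]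
  have XY': "opX (opY u) q = -2 * opT u q" and YX: "opY (opX u) q = 2 * opT u q" if "q \<in> \<Omega>" for q
    using commutators(1)[OF u that] XY[OF that] by simp_all
  \<comment> \<open>\<open>X^3 u = X Y^2 u = (Y X - 4 T) Y u\<close>, and
    \<open>Y X Y u = -2 Y T u = -2 T Y u\<close>.\<close>
  have XA: "opX (opX (opX u)) q = -6 * opT (opY u) q" if q: "q \<in> \<Omega>" for q
  proof -
    have "opX (opX (opX u)) q = opX (opY (opY u)) q" by (rule cong[OF q XX])
    also have "\<dots> = opY (opX (opY u)) q - 4 * opT (opY u) q"
      by (rule commutators(1)[OF _ q]) (intro smooth)
    also have "opY (opX (opY u)) q = -2 * opY (opT u) q"
      by (rule cmult[OF q XY']) (auto intro: smooth)
    also have "opY (opT u) q = opT (opY u) q" by (rule commutators(3)[OF u q])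
    finally show ?thesis by simp
  qed
  \<comment> \<open>The commutator applied to \<open>X u\<close> gives
    \<open>Y X^2 u = X Y X u + 4 T X u\<close>, where
    \<open>X Y X u = 2 X T u = 2 T X u\<close>.\<close>
  have YA: "opY (opX (opX u)) q = 6 * opT (opX u) q" if q: "q \<in> \<Omega>" for q
  proof -
    have "opX (opY (opX u)) q = opY (opX (opX u)) q - 4 * opT (opX u) q"
      by (rule commutators(1)[OF _ q]) (intro smooth)
    moreover have "opX (opY (opX u)) q = 2 * opX (opT u) q"
      by (rule cmult[OF q YX]) (auto intro: smooth)
    moreover have "opX (opT u) q = opT (opX u) q" by (rule commutators(2)[OF u q])
    ultimately show ?thesis by simp
  qed
  \<comment> \<open>The commutator is now applied to \<open>A = X^2 u\<close> itself. By the two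
    formulas just found \<open>X Y A = 6 T A\<close>, and
    \<open>Y X A = -6 T Y^2 u = -6 T A\<close>; so \<open>6 T A = -6 T A - 4 T A\<close>.\<close>
  have TA: "opT (opX (opX u)) q = 0" if q: "q \<in> \<Omega>" for q
  proof -
    let ?A = "opX (opX u)"
    have "opX (opY ?A) q = opY (opX ?A) q - 4 * opT ?A q"
      by (rule commutators(1)[OF _ q]) (intro smooth)
    moreover have "opX (opY ?A) q = 6 * opX (opT (opX u)) q"
      by (rule cmult[OF q YA]) (auto intro: smooth)
    moreover have "opX (opT (opX u)) q = opT ?A q"
      by (rule commutators(2)[OF _ q]) (intro smooth)
    moreover have "opY (opX ?A) q = -6 * opY (opT (opY u)) q"
      by (rule cmult[OF q XA]) (auto intro: smooth)
    moreover have "opY (opT (opY u)) q = opT (opY (opY u)) q"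
      by (rule commutators(3)[OF _ q]) (intro smooth)
    moreover have "opT (opY (opY u)) q = opT ?A q"
      by (rule cong[OF q XX[symmetric]])
    ultimately show ?thesis by simp
  qed
  \<comment> \<open>\<open>T\<close> commutes with \<open>X\<close> and \<open>Y\<close>, so
    \<open>T A = 0\<close> gives \<open>T X A = T Y A = 0\<close>; these are
    \<open>-6 T^2 Y u\<close> and \<open>6 T^2 X u\<close>.\<close>
  have TTX: "opT (opT (opX u)) q = 0" and TTY: "opT (opT (opY u)) q = 0" if q: "q \<in> \<Omega>" for q
  proof -
    let ?A = "opX (opX u)"
    have "opT (opX ?A) q = opX (opT ?A) q" "opT (opY ?A) q = opY (opT ?A) q"
      by (rule commutators(2,3)[OF _ q, symmetric], intro smooth)+
    moreover have "opX (opT ?A) q = 0" "opY (opT ?A) q = 0"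
      by (rule deriv_along_zero_on[OF \<Omega> q TA], assumption)+
    moreover have "opT (opX ?A) q = -6 * opT (opT (opY u)) q"
      by (rule cmult[OF q XA]) (auto intro: smooth)
    moreover have "opT (opY ?A) q = 6 * opT (opT (opX u)) q"
      by (rule cmult[OF q YA]) (auto intro: smooth)
    ultimately show "opT (opT (opX u)) q = 0" "opT (opT (opY u)) q = 0" by simp_all
  qed
  \<comment> \<open>Two derivatives along \<open>T\<close> of \<open>X Y u = -2 T u\<close> express
    \<open>T^3 u\<close> through \<open>X T^2 Y u\<close>, which vanishes.\<close>
  have TXY: "opT (opX (opY u)) q = -2 * opT (opT u) q" if q: "q \<in> \<Omega>" for q
    by (rule cmult[OF q XY']) (auto intro: smooth)
  have "opT (opT (opX (opY u))) p = -2 * opT (opT (opT u)) p"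
    by (rule cmult[OF p TXY]) (auto intro: smooth)
  moreover have "opT (opT (opX (opY u))) p = opT (opX (opT (opY u))) p"
    by (rule cong[OF p], rule commutators(2)[symmetric]) (intro smooth)
  moreover have "opT (opX (opT (opY u))) p = opX (opT (opT (opY u))) p"
    by (rule commutators(2)[OF _ p, symmetric]) (intro smooth)
  moreover have "opX (opT (opT (opY u))) p = 0"
    by (rule deriv_along_zero_on[OF \<Omega> p TTY])
  ultimately show "opT (opT (opT u)) p = 0" by simp
  show "opX (opY u) p = -2 * opT u p" "opY (opX u) p = 2 * opT u p"
    "opX (opX (opX u)) p = -6 * opT (opY u) p" "opY (opX (opX u)) p = 6 * opT (opX u) p"
    "opT (opX (opX u)) p = 0" "opT (opT (opX u)) p = 0" "opT (opT (opY u)) p = 0"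
    by (rule XY'[OF p] YX[OF p] XA[OF p] YA[OF p] TA[OF p] TTX[OF p] TTY[OF p])+
qed

text \<open>The unknowns are integrated in an order in which all frame derivatives of the next one
  are already explicit.\<close>

lemma pde_solution:
  assumes conn: "connected \<Omega>"
  obtains c1 c2 c3 c4 c5 c6 c7 c8 where "\<And>p. p \<in> \<Omega> \<Longrightarrow>
    u p = polyU c1 c2 c3 c4 c5 c6 c7 c8 (Re (fst p)) (Im (fst p)) (snd p)"
proof -
  note smooth = smooth_ops u
  note integrate = partials_integrate[OF \<Omega> conn]
  have sm: "smooth_on \<Omega> (opT (opT u))" "smooth_on \<Omega> (opT (opX u))" "smooth_on \<Omega> (opT (opY u))"
    "smooth_on \<Omega> (opT u)" "smooth_on \<Omega> (opX (opX u))" "smooth_on \<Omega> (opX u)" "smooth_on \<Omega> (opY u)"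
    "smooth_on \<Omega> u"
    by (intro smooth)+
  have partials0: "has_partials (\<lambda>_. 0) 0 0 0 p" for p by simp
  have comm_T: "opX (opT v) p = opT (opX v) p" "opY (opT v) p = opT (opY v) p"
    if "smooth_on \<Omega> v" "p \<in> \<Omega>" for v :: "heis \<Rightarrow> real" and p
    using commutators(2,3)[OF that] .
  have TTX: "opX (opT (opT u)) p = 0" and TTY: "opY (opT (opT u)) p = 0" if "p \<in> \<Omega>" for p
  proof -
    have "opX (opT (opT u)) p = opT (opX (opT u)) p" "opY (opT (opT u)) p = opT (opY (opT u)) p"
      by (rule comm_T[OF _ that], intro smooth)+
    moreover have "opT (opX (opT u)) p = opT (opT (opX u)) p" "opT (opY (opT u)) p = opT (opT (opY u)) p"
      by (rule deriv_along_cong[OF \<Omega> that], erule comm_T[OF u])+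
    ultimately show "opX (opT (opT u)) p = 0" "opY (opT (opT u)) p = 0"
      using pde_consequences[OF that] by simp_all
  qed
  have TXX: "opX (opT (opX u)) p = 0" "opY (opT (opX u)) p = 2 * opT (opT u) p"
    and TYY: "opX (opT (opY u)) p = -2 * opT (opT u) p" "opY (opT (opY u)) p = 0" if "p \<in> \<Omega>" for p
  proof -
    have "opX (opT (opX u)) p = opT (opX (opX u)) p" "opY (opT (opX u)) p = opT (opY (opX u)) p"
      "opX (opT (opY u)) p = opT (opX (opY u)) p" "opY (opT (opY u)) p = opT (opY (opY u)) p"
      by (rule comm_T[OF _ that], intro smooth)+
    moreover have "opT (opY (opX u)) p = 2 * opT (opT u) p" "opT (opX (opY u)) p = -2 * opT (opT u) p"
      by (rule deriv_along_cmult_on[OF \<Omega> that], erule pde_consequences, intro smooth)+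
    moreover have "opT (opX (opX u)) p = opT (opY (opY u)) p"
      by (rule deriv_along_cong[OF \<Omega> that], erule XX)
    ultimately show "opX (opT (opX u)) p = 0" "opY (opT (opX u)) p = 2 * opT (opT u) p"
      "opX (opT (opY u)) p = -2 * opT (opT u) p" "opY (opT (opY u)) p = 0"
      using pde_consequences[OF that] by simp_all
  qed
  obtain d1 where d1: "opT (opT u) p = d1" if "p \<in> \<Omega>" for p
    by (rule integrate[OF sm(1) partials0])
      (use smooth TTX TTY pde_consequences(8) in auto)
  \<comment> \<open>The term \<open>c1 * t^2\<close> of the solution contributes
    \<open>2 * c1\<close> to \<open>T^2 u\<close>, hence the factor 1/2.\<close>
  define c1 where "c1 = d1 / 2"
  have TT: "opT (opT u) p = 2 * c1" if "p \<in> \<Omega>" for p using d1[OF that] by (simp add: c1_def)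
  \<comment> \<open>The primitive comes from \<open>X T X u = 0\<close> and
    \<open>Y T X u = 2 T^2 u = 4 c1\<close>.\<close>
  have "has_partials (\<lambda>p. 4 * c1 * Im (fst p)) 0 (4 * c1) 0 p" for p
    by (auto intro!: derivative_eq_intros)
  from integrate[OF sm(2) this]
  obtain c3 where TX: "opT (opX u) p = 4 * c1 * Im (fst p) + c3" if "p \<in> \<Omega>" for p
    using smooth TXX TT pde_consequences(6) by auto
  have "has_partials (\<lambda>p. -4 * c1 * Re (fst p)) (-4 * c1) 0 0 p" for p
    by (auto intro!: derivative_eq_intros)
  from integrate[OF sm(3) this]
  obtain c2 where TY: "opT (opY u) p = -4 * c1 * Re (fst p) + c2" if "p \<in> \<Omega>" for p
    using smooth TYY TT pde_consequences(7) by auto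
  have "has_partials (\<lambda>p. 2 * c1 * snd p + c2 * Im (fst p) + c3 * Re (fst p)) c3 c2 (2 * c1) p" for p
    by (auto intro!: derivative_eq_intros)
  from integrate[OF sm(4) this]
  obtain c7 where T: "opT u p = 2 * c1 * snd p + c2 * Im (fst p) + c3 * Re (fst p) + c7"
      if "p \<in> \<Omega>" for p
    using smooth comm_T[OF u] TX TY TT by auto
  \<comment> \<open>Since \<open>T X^2 u = 0\<close>, the coordinate partials of
    \<open>X^2 u\<close> are its derivatives along \<open>X\<close> and \<open>Y\<close>, namely
    \<open>-6 T Y u\<close> and \<open>6 T X u\<close>.\<close>
  have "has_partials (\<lambda>p. 12 * c1 * ((Re (fst p))\<^sup>2 + (Im (fst p))\<^sup>2) - 6 * c2 * Re (fst p)
      + 6 * c3 * Im (fst p)) (24 * c1 * Re (fst p) - 6 * c2) (24 * c1 * Im (fst p) + 6 * c3) 0 p" for p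
    by (auto intro!: derivative_eq_intros simp: fun_eq_iff algebra_simps)
  from integrate[OF sm(5) this]
  obtain d4 where d4: "opX (opX u) p = 12 * c1 * ((Re (fst p))\<^sup>2 + (Im (fst p))\<^sup>2) - 6 * c2 * Re (fst p)
      + 6 * c3 * Im (fst p) + d4" if "p \<in> \<Omega>" for p
    using smooth pde_consequences(3-5) TX TY by auto
  \<comment> \<open>The term \<open>c4 * x^2\<close> contributes \<open>2 * c4\<close> to
    \<open>X^2 u\<close>.\<close>
  define c4 where "c4 = d4 / 2"
  have A: "opX (opX u) p = 12 * c1 * ((Re (fst p))\<^sup>2 + (Im (fst p))\<^sup>2) - 6 * c2 * Re (fst p)
      + 6 * c3 * Im (fst p) + 2 * c4" if "p \<in> \<Omega>" for p
    using d4[OF that] by (simp add: c4_def)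
  \<comment> \<open>The argument 0 holds the place of the additive constant, which the integration
    supplies as \<open>c5\<close>; \<open>c6\<close> and \<open>c8\<close> arise in the same
    way.\<close>
  obtain c5 where c5: "opX u p = polyXU c1 c2 c3 c4 0 c7 (Re (fst p)) (Im (fst p)) (snd p) + c5"
      if "p \<in> \<Omega>" for p
    by (rule integrate[OF sm(6) partials_polyXU])
      (use smooth pde_consequences(2) TX T A in \<open>auto simp: algebra_simps power2_eq_square\<close>)
  obtain c6 where c6: "opY u p = polyYU c1 c2 c3 c4 0 c7 (Re (fst p)) (Im (fst p)) (snd p) + c6"
      if "p \<in> \<Omega>" for p
    by (rule integrate[OF sm(7) partials_polyYU])
      (use smooth pde_consequences(1) TY T A XX in \<open>auto simp: algebra_simps power2_eq_square\<close>)
  obtain c8 where "u p = polyU c1 c2 c3 c4 c5 c6 c7 0 (Re (fst p)) (Im (fst p)) (snd p) + c8"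
      if "p \<in> \<Omega>" for p
    by (rule integrate[OF sm(8) partials_polyU])
      (use smooth c5 c6 T in \<open>auto simp: polyXU_def polyYU_def algebra_simps power2_eq_square\<close>)
  then show ?thesis by (intro that[of c1 c2 c3 c4 c5 c6 c7 c8]) (simp add: polyU_def)
qed

end

section \<open>The complex operator \<open>Z\<close> on real functions\<close>

lemma deriv_along_scaleR_add:
  fixes a b :: "heis \<Rightarrow> real" and c d :: complex
  assumes "a differentiable (at p)" "b differentiable (at p)"
  shows "deriv_along W (\<lambda>q. a q *\<^sub>R c + b q *\<^sub>R d) p = deriv_along W a p *\<^sub>R c + deriv_along W b p *\<^sub>R d"
  unfolding deriv_along_def[of W a] deriv_along_def[of W b]
  by (rule deriv_along_eq)
    (intro has_derivative_add has_derivative_scaleR_left assms[unfolded frechet_derivative_works])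

lemma opZ_scaleR_add:
  assumes "a differentiable (at p)" "b differentiable (at p)"
  shows "opZ (\<lambda>q. a q *\<^sub>R c + b q *\<^sub>R d) p =
    (1/2) * ((of_real (opX a p) - \<i> * of_real (opY a p)) * c
      + (of_real (opX b p) - \<i> * of_real (opY b p)) * d)"
  unfolding opZ_def deriv_along_scaleR_add[OF assms] by (simp add: scaleR_conv_of_real algebra_simps)

lemma opZ_cong:
  assumes "open \<Omega>" "p \<in> \<Omega>" "\<And>q. q \<in> \<Omega> \<Longrightarrow> f q = g q"
  shows "opZ f p = opZ g p"
  using assms(3) by (simp add: opZ_def deriv_along_cong[OF assms(1,2), of f g])

text \<open>Expanding without commuting gives \<open>4 Z^2 = X^2 - Y^2 - \<i> (X Y + Y X)\<close>.
  For real \<open>u\<close> the real and imaginary parts of \<open>Z^2 u\<close> are therefore the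
  two equations of the second condition, up to factors.\<close>

lemma opZ_opZ_of_real:
  fixes u :: "heis \<Rightarrow> real"
  assumes \<Omega>: "open \<Omega>" and u: "smooth_on \<Omega> u" and p: "p \<in> \<Omega>"
  shows "opZ (opZ (\<lambda>q. complex_of_real (u q))) p =
    Complex ((opX (opX u) p - opY (opY u) p) / 4) (- (opX (opY u) p + opY (opX u) p) / 4)"
proof -
  \<comment> \<open>\<open>Z u\<close> is written as a combination of two fixed complex numbers with
    real coefficients, so its derivatives reduce to those of \<open>X u\<close> and
    \<open>Y u\<close>.\<close>
  have "opZ (\<lambda>q. complex_of_real (u q)) q = opX u q *\<^sub>R (1/2) + opY u q *\<^sub>R (- \<i> / 2)" if "q \<in> \<Omega>" for q
    using opZ_scaleR_add[OF smooth_on_differentiable[OF u that] smooth_on_differentiable[OF u that], of 1 0]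
    by (simp add: scaleR_conv_of_real algebra_simps add_divide_distrib diff_divide_distrib)
  then have "opZ (opZ (\<lambda>q. complex_of_real (u q))) p =
      opZ (\<lambda>q. opX u q *\<^sub>R (1/2) + opY u q *\<^sub>R (- \<i> / 2)) p"
    by (rule opZ_cong[OF \<Omega> p])
  also have "\<dots> = (1/2) * ((of_real (opX (opX u) p) - \<i> * of_real (opY (opX u) p)) * (1/2)
      + (of_real (opX (opY u) p) - \<i> * of_real (opY (opY u) p)) * (- \<i> / 2))"
    by (intro opZ_scaleR_add smooth_on_differentiable[OF _ p] smooth_on_opX smooth_on_opY \<Omega> u)
  finally show ?thesis by (simp add: complex_eq_iff field_simps)
qed

section \<open>Variation of flows\<close>

text \<open>Multiplication by the integrating factor \<open>exp (- C x)\<close>, with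
  \<open>C\<close> a primitive of \<open>c\<close>, makes the solution constant, and it vanishes at
  0.\<close>

lemma linear_ode_zero:
  fixes u c :: "real \<Rightarrow> complex"
  assumes J: "is_interval J" "0 \<in> J" "s \<in> J"
    and c: "continuous_on J c"
    and u: "\<And>r. r \<in> J \<Longrightarrow> (u has_vector_derivative c r * u r) (at r)" and "u 0 = 0"
  shows "u s = 0"
proof -
  \<comment> \<open>The interval between 0 and \<open>s\<close>, for either sign of
    \<open>s\<close>. Starting the primitive at \<open>a\<close> instead of 0 only rescales the
    integrating factor.\<close>
  define a b where "a = min 0 s" and "b = max 0 s"
  have ab: "{a..b} \<subseteq> J"
  proof
    fix x assume "x \<in> {a..b}"
    moreover have "a \<in> J" "b \<in> J" using J by (simp_all add: a_def b_def min_def max_def)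
    ultimately show "x \<in> J" using mem_is_interval_1_I[OF J(1), of a b x] by simp
  qed
  define C where "C x = integral {a..x} c" for x
  have "((\<lambda>x. exp (- C x) * u x) has_derivative (\<lambda>h. 0)) (at x within {a..b})" if x: "x \<in> {a..b}" for x
  proof -
    have C: "(C has_vector_derivative c x) (at x within {a..b})"
      unfolding C_def by (rule integral_has_vector_derivative[OF continuous_on_subset[OF c ab] x])
    have E: "((\<lambda>x. exp (- C x)) has_vector_derivative - c x * exp (- C x)) (at x within {a..b})"
      using field_vector_diff_chain_within[OF has_vector_derivative_minus[OF C]
          has_field_derivative_at_within[OF DERIV_exp]] by (simp add: o_def)
    have "(u has_vector_derivative c x * u x) (at x within {a..b})"
      by (rule has_vector_derivative_at_within[OF u]) (use ab x in blast)
    from has_vector_derivative_mult[OF E this]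
    have "((\<lambda>x. exp (- C x) * u x) has_vector_derivative 0) (at x within {a..b})"
      by (simp add: algebra_simps)
    then show ?thesis by (simp add: has_vector_derivative_def)
  qed
  then obtain d where "\<And>x. x \<in> {a..b} \<Longrightarrow> exp (- C x) * u x = d"
    using has_derivative_zero_constant[of "{a..b}" "\<lambda>x. exp (- C x) * u x"] by auto
  from this[of 0] this[of s] show ?thesis using \<open>u 0 = 0\<close> by (simp add: a_def b_def)
qed

context
  fixes \<Omega> U :: "heis set" and V :: "heis \<Rightarrow> heis" and J :: "real set" and \<Phi> :: "real \<Rightarrow> heis \<Rightarrow> heis"
  assumes V: "smooth_on \<Omega> V" and flow: "local_flow \<Omega> V J U \<Phi>"
begin

text \<open>Chain rule for \<open>q \<mapsto> (s, q)\<close>. It turns spatial derivatives into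
  derivatives of the joint map, where symmetry of second derivatives is available.\<close>

lemma flow_deriv_space:
  assumes "s \<in> J" "p \<in> U"
  shows "(\<Phi> s has_derivative (\<lambda>w. frechet_derivative (\<lambda>(s, p). \<Phi> s p) (at (s, p)) (0, w))) (at p)"
proof -
  have "(\<lambda>(s, p). \<Phi> s p) differentiable (at (s, p))"
    using flow assms by (intro smooth_on_differentiable[where S = "J \<times> U"]) (auto simp: local_flow_def)
  moreover have "((\<lambda>q. (s, q)) has_derivative (\<lambda>w. (0, w))) (at p)"
    by (auto intro!: derivative_eq_intros)
  ultimately show ?thesis
    unfolding frechet_derivative_works by (auto dest: has_derivative_compose)
qed

lemma flow_differentiable: "s \<in> J \<Longrightarrow> p \<in> U \<Longrightarrow> \<Phi> s differentiable (at p)"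
  by (rule differentiableI[OF flow_deriv_space])

text \<open>The variational equation: the flow equation is differentiated in the spatial direction
  \<open>w\<close>, and time and space derivatives are interchanged.\<close>

lemma flow_variation:
  assumes s: "s \<in> J" and p: "p \<in> U"
  shows "((\<lambda>r. frechet_derivative (\<Phi> r) (at p) w) has_vector_derivative
    frechet_derivative V (at (\<Phi> s p)) (frechet_derivative (\<Phi> s) (at p) w)) (at s)"
proof -
  let ?F = "\<lambda>(s, p). \<Phi> s p" and ?S = "J \<times> U"
  have open_S: "open ?S" and smooth: "smooth_on ?S ?F" and J: "open J"
    and \<Phi>: "\<And>r q. r \<in> J \<Longrightarrow> q \<in> U \<Longrightarrow> \<Phi> r q \<in> \<Omega>"
    and ode: "\<And>r q. r \<in> J \<Longrightarrow> q \<in> U \<Longrightarrow> ((\<lambda>r. \<Phi> r q) has_vector_derivative V (\<Phi> r q)) (at r)"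
    using flow unfolding local_flow_def by (blast intro: open_Times)+
  have sp: "(s, p) \<in> ?S" using s p by simp
  have time: "((\<lambda>r. g (r, q)) has_vector_derivative frechet_derivative g (at (r, q)) (1, 0)) (at r)"
    if "g differentiable (at (r, q))" for g :: "real \<times> heis \<Rightarrow> heis" and r q
  proof -
    have g: "(g has_derivative frechet_derivative g (at (r, q))) (at (r, q))"
      using that frechet_derivative_works by blast
    have "((\<lambda>r. (r, q)) has_derivative (\<lambda>h. (h, 0))) (at r)"
      by (auto intro!: derivative_eq_intros)
    from has_derivative_compose[OF this g]
    have "((\<lambda>r. g (r, q)) has_derivative (\<lambda>h. frechet_derivative g (at (r, q)) (h, 0))) (at r)" .
    also have "(\<lambda>h. frechet_derivative g (at (r, q)) (h, 0)) =
        (\<lambda>h. h *\<^sub>R frechet_derivative g (at (r, q)) (1, 0))"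
    proof
      show "frechet_derivative g (at (r, q)) (h, 0) = h *\<^sub>R frechet_derivative g (at (r, q)) (1, 0)" for h
        using linear_scale[OF has_derivative_linear[OF g], of h "(1, 0)"] by simp
    qed
    finally show ?thesis unfolding has_vector_derivative_def .
  qed
  \<comment> \<open>This holds on all of the open set \<open>J \<times> U\<close>, so both sides may
    be differentiated in space.\<close>
  have "frechet_derivative ?F (at x) (1, 0) = V (?F x)" if "x \<in> ?S" for x
  proof -
    obtain r q where Pair: "x = (r, q)" by (rule prod.exhaust)
    have rq: "r \<in> J" "q \<in> U" using that by (simp_all add: Pair)
    show ?thesis
      using vector_derivative_unique_at[OF time[OF smooth_on_differentiable[OF smooth that[unfolded Pair]],
            unfolded case_prod_conv] ode[OF rq]]
      by (simp add: Pair)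
  qed
  then have "frechet_derivative (\<lambda>x. frechet_derivative ?F (at x) (1, 0)) (at (s, p)) (0, w) =
      frechet_derivative (\<lambda>x. V (?F x)) (at (s, p)) (0, w)"
    by (subst frechet_derivative_cong_open[OF open_S sp]) auto
  also have "\<dots> = frechet_derivative V (at (\<Phi> s p)) (frechet_derivative ?F (at (s, p)) (0, w))"
    using frechet_derivative_compose[of ?F "(s, p)" V] smooth_on_differentiable[OF smooth sp]
      smooth_on_differentiable[OF V \<Phi>[OF s p]]
    by (simp add: o_def)
  \<comment> \<open>Symmetry of second derivatives on \<open>J \<times> U\<close>, for the
    directions \<open>(0, w)\<close> and \<open>(1, 0)\<close>.\<close>
  finally have *: "frechet_derivative (\<lambda>x. frechet_derivative ?F (at x) (0, w)) (at (s, p)) (1, 0) =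
      frechet_derivative V (at (\<Phi> s p)) (frechet_derivative (\<Phi> s) (at p) w)"
    unfolding frechet_derivative_eq[OF flow_deriv_space[OF s p]]
      frechet_derivative_commute_euclidean[OF open_S smooth sp, of "(0, w)"] .
  have "((\<lambda>r. frechet_derivative ?F (at (r, p)) (0, w)) has_vector_derivative
      frechet_derivative V (at (\<Phi> s p)) (frechet_derivative (\<Phi> s) (at p) w)) (at s)"
    using time[OF smooth_on_differentiable[OF smooth_on_frechet_derivative[OF smooth, of "(0, w)"] sp]]
    unfolding * .
  then show ?thesis
    by (rule has_vector_derivative_transform_within_open[OF _ J s])
      (simp add: frechet_derivative_eq[OF flow_deriv_space[OF _ p]])
qed

lemma flow_derivative_0:
  assumes p: "p \<in> U"
  shows "frechet_derivative (\<Phi> 0) (at p) w = w"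
proof -
  have "frechet_derivative (\<Phi> 0) (at p) = frechet_derivative (\<lambda>q. q) (at p)"
    using flow p by (intro frechet_derivative_cong_open[where S = U]) (auto simp: local_flow_def)
  also have "\<dots> = (\<lambda>w. w)" by (rule frechet_derivative_eq) simp
  finally show ?thesis by simp
qed

end

section \<open>Contact and conformal flows\<close>

text \<open>\<theta> is linear in the vector, and its coefficients are linear in the base point. The
  second term comes from moving the base point and is half of
  \<open>d\<theta>(a' h, b x)\<close>.\<close>

lemma has_derivative_contact_form:
  assumes "(a has_derivative a') (at x)" "(b has_derivative b') (at x)"
  shows "((\<lambda>r. contact_form (a r) (b r)) has_derivative (\<lambda>h. contact_form (a x) (b' h)
    + 2 * (Re (fst (a' h)) * Im (fst (b x)) - Im (fst (a' h)) * Re (fst (b x))))) (at x)"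
  unfolding contact_form_def
  by (auto intro!: derivative_eq_intros assms simp: algebra_simps)

lemma contact_form_fieldX: "contact_form p (fieldX p) = 0"
  and contact_form_fieldY: "contact_form p (fieldY p) = 0"
  by (simp_all add: contact_form_def fieldX_def fieldY_def)

lemma deriv_along_Re_fst:
  fixes f :: "heis \<Rightarrow> heis"
  assumes "f differentiable (at p)"
  shows "deriv_along W (\<lambda>q. Re (fst (f q))) p = Re (fst (frechet_derivative f (at p) (W p)))"
  unfolding deriv_along_def
  by (rule fun_cong[OF frechet_derivative_bounded_linear_compose[OF bounded_linear_Re_fst assms]])

lemma deriv_along_Im_fst:
  fixes f :: "heis \<Rightarrow> heis"
  assumes "f differentiable (at p)"
  shows "deriv_along W (\<lambda>q. Im (fst (f q))) p = Im (fst (frechet_derivative f (at p) (W p)))"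
  unfolding deriv_along_def
  by (rule fun_cong[OF frechet_derivative_bounded_linear_compose[OF bounded_linear_Im_fst assms]])

text \<open>The components of \<open>h\<close> are \<open>X f1\<close>, \<open>X f2\<close> and
  those of \<open>k\<close> are \<open>Y f1\<close>, \<open>Y f2\<close>, so conformality says that
  \<open>h\<close> and \<open>k\<close> are orthogonal vectors of equal length.\<close>

lemma conformal_map_on_iff:
  assumes "\<And>p. p \<in> U \<Longrightarrow> f differentiable (at p)"
  shows "conformal_map_on U f \<longleftrightarrow> contact_map_on U f \<and> (\<forall>p\<in>U.
    let h = fst (frechet_derivative f (at p) (fieldX p)); k = fst (frechet_derivative f (at p) (fieldY p))
    in (Re h)\<^sup>2 + (Im h)\<^sup>2 = (Re k)\<^sup>2 + (Im k)\<^sup>2 \<and> Re h * Re k + Im h * Im k = 0)"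
  unfolding conformal_map_on_def Let_def
  by (simp add: deriv_along_Re_fst deriv_along_Im_fst assms cong: ball_cong)

lemma contact_map_horizontal:
  assumes "contact_map_on U f" "p \<in> U" "contact_form p w = 0"
  shows "contact_form (f p) (frechet_derivative f (at p) w) = 0"
  using assms unfolding contact_map_on_def by (metis mult_zero_right)

lemma has_derivative_const_on_open_imp_0:
  assumes "(f has_derivative f') (at x)" "open S" "x \<in> S" "\<And>y. y \<in> S \<Longrightarrow> f y = c"
  shows "f' h = 0"
proof -
  have "((\<lambda>_. c) has_derivative f') (at x)"
    by (rule has_derivative_transform_within_open[OF assms(1-3)]) (rule assms(4))
  then have "f' = (\<lambda>_. 0)"
    by (rule has_derivative_unique[OF _ has_derivative_const])
  then show ?thesis by simp
qed

section \<open>Infinitesimal form of the contact and conformal conditions\<close>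

context
  fixes \<Omega> :: "heis set" and V :: "heis \<Rightarrow> heis" and v0 v1 v2 :: "heis \<Rightarrow> real"
  assumes \<Omega>: "open \<Omega>" and V: "smooth_on \<Omega> V"
    and V_eq: "\<And>p. p \<in> \<Omega> \<Longrightarrow> V p = v1 p *\<^sub>R fieldX p + v2 p *\<^sub>R fieldY p - (4 * v0 p) *\<^sub>R fieldT p"
begin

text \<open>\<theta> vanishes on \<open>X\<close> and \<open>Y\<close> and is 1 on \<open>T\<close>,
  so \<open>\<theta>(V) = -4 v0\<close>. The components inherit smoothness from \<open>V\<close>
  through these formulas.\<close>

lemma V_components:
  assumes "p \<in> \<Omega>"
  shows "v1 p = Re (fst (V p))" "v2 p = Im (fst (V p))" "v0 p = - (1/4) * contact_form p (V p)"
  using V_eq[OF assms] by (simp_all add: fieldX_def fieldY_def fieldT_def contact_form_def algebra_simps)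

lemma smooth_v0: "smooth_on \<Omega> v0"
proof -
  have "smooth_on \<Omega> (\<lambda>p. - (1/4) * (snd (V p) + (-2) * (Im (fst p) * Re (fst (V p)))
      + 2 * (Re (fst p) * Im (fst (V p)))))"
    by (intro smooth_on_add smooth_on_mult smooth_on_const \<Omega> V
        smooth_on_bounded_linear[OF bounded_linear_Re_fst] smooth_on_bounded_linear[OF bounded_linear_Im_fst]
        smooth_on_bounded_linear_compose[OF \<Omega> bounded_linear_Re_fst]
        smooth_on_bounded_linear_compose[OF \<Omega> bounded_linear_Im_fst]
        smooth_on_bounded_linear_compose[OF \<Omega> bounded_linear_snd])
  then show ?thesis
    by (rule smooth_on_cong[OF \<Omega>, THEN iffD1, rotated]) (simp add: V_components contact_form_def)
qed

lemma smooth_v1: "smooth_on \<Omega> v1"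
  using smooth_on_bounded_linear_compose[OF \<Omega> bounded_linear_Re_fst V]
  by (rule smooth_on_cong[OF \<Omega>, THEN iffD1, rotated]) (simp add: V_components)

lemma smooth_v2: "smooth_on \<Omega> v2"
  using smooth_on_bounded_linear_compose[OF \<Omega> bounded_linear_Im_fst V]
  by (rule smooth_on_cong[OF \<Omega>, THEN iffD1, rotated]) (simp add: V_components)

lemma frechet_derivative_v0:
  assumes p: "p \<in> \<Omega>"
  shows "-4 * frechet_derivative v0 (at p) w = contact_form p (frechet_derivative V (at p) w)
    + 2 * (Re (fst w) * v2 p - Im (fst w) * v1 p)"
proof -
  have "(V has_derivative frechet_derivative V (at p)) (at p)"
    using smooth_on_differentiable[OF V p] frechet_derivative_works by blast
  from has_derivative_contact_form[OF has_derivative_ident this]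
  have "((\<lambda>q. - (1/4) * contact_form q (V q)) has_derivative
      (\<lambda>w. - (1/4) * (contact_form p (frechet_derivative V (at p) w)
        + 2 * (Re (fst w) * Im (fst (V p)) - Im (fst w) * Re (fst (V p)))))) (at p)"
    by (rule has_derivative_mult_right)
  moreover have "frechet_derivative v0 (at p) = frechet_derivative (\<lambda>q. - (1/4) * contact_form q (V q)) (at p)"
    by (rule frechet_derivative_cong_open[OF \<Omega> p V_components(3)])
  ultimately show ?thesis
    by (simp add: frechet_derivative_eq V_components[OF p] field_simps)
qed

text \<open>A horizontal \<open>w\<close> is a combination of \<open>X\<close> and \<open>Y\<close>
  alone, so no derivative along \<open>T\<close> enters.\<close>

lemma frechet_derivative_V:
  assumes p: "p \<in> \<Omega>" and w: "contact_form p w = 0"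
  shows "fst (frechet_derivative V (at p) w) =
    Complex (Re (fst w) * opX v1 p + Im (fst w) * opY v1 p) (Re (fst w) * opX v2 p + Im (fst w) * opY v2 p)"
proof -
  note dV = smooth_on_differentiable[OF V p]
  have "deriv_along (\<lambda>_. w) v1 p = deriv_along (\<lambda>_. w) (\<lambda>q. Re (fst (V q))) p"
    by (rule deriv_along_cong[OF \<Omega> p V_components(1)])
  moreover have "deriv_along (\<lambda>_. w) v2 p = deriv_along (\<lambda>_. w) (\<lambda>q. Im (fst (V q))) p"
    by (rule deriv_along_cong[OF \<Omega> p V_components(2)])
  ultimately show ?thesis
    using deriv_along_partials[OF smooth_on_differentiable[OF smooth_v1 p], of "\<lambda>_. w"]
      deriv_along_partials[OF smooth_on_differentiable[OF smooth_v2 p], of "\<lambda>_. w"] w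
    by (simp add: deriv_along_Re_fst[OF dV] deriv_along_Im_fst[OF dV] complex_eq_iff)
qed

lemma contact_field_partials:
  assumes "contact_field_on \<Omega> V" and p: "p \<in> \<Omega>"
  shows "opX v0 p = - v2 p" "opY v0 p = v1 p"
proof -
  obtain J U \<Phi> where flow: "p \<in> U" "local_flow \<Omega> V J U \<Phi>"
    and contact: "\<And>s. s \<in> J \<Longrightarrow> contact_map_on U (\<Phi> s)"
    using assms unfolding contact_field_on_def flow_consists_of_def by meson
  then have J: "open J" "0 \<in> J" and \<Phi>0: "\<Phi> 0 p = p"
    and ode: "((\<lambda>r. \<Phi> r p) has_vector_derivative V (\<Phi> 0 p)) (at 0)"
    unfolding local_flow_def by blast+
  have "frechet_derivative v0 (at p) w = Im (fst w) * v1 p - Re (fst w) * v2 p"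
    if w: "contact_form p w = 0" for w
  proof -
    have "((\<lambda>r. frechet_derivative (\<Phi> r) (at p) w) has_vector_derivative frechet_derivative V (at p) w) (at 0)"
      using flow_variation[OF V flow(2) J(2) flow(1), of w] flow_derivative_0[OF V flow(2,1)] \<Phi>0 by simp
    from has_derivative_contact_form[OF ode[unfolded has_vector_derivative_def] this[unfolded has_vector_derivative_def]]
    \<comment> \<open>The derivative at 0 of \<open>\<theta>(D\<Phi>\<^sub>s w)\<close>, which is
      constantly 0 for horizontal \<open>w\<close>; the base point moves with velocity
      \<open>V\<close>.\<close>
    have "contact_form (\<Phi> 0 p) (1 *\<^sub>R frechet_derivative V (at p) w)
        + 2 * (Re (fst (1 *\<^sub>R V (\<Phi> 0 p))) * Im (fst (frechet_derivative (\<Phi> 0) (at p) w))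
          - Im (fst (1 *\<^sub>R V (\<Phi> 0 p))) * Re (fst (frechet_derivative (\<Phi> 0) (at p) w))) = 0"
      by (rule has_derivative_const_on_open_imp_0[OF _ J])
        (rule contact_map_horizontal[OF contact flow(1) w])
    then have "contact_form p (frechet_derivative V (at p) w)
        + 2 * (v1 p * Im (fst w) - v2 p * Re (fst w)) = 0"
      by (simp add: \<Phi>0 flow_derivative_0[OF V flow(2,1)] V_components[OF p])
    \<comment> \<open>Two equal base-point contributions add up, one from the flow and one from
      differentiating \<open>\<theta>(V) = -4 v0\<close>; their sum is -4 times the claimed
      value.\<close>
    with frechet_derivative_v0[OF p, of w] show ?thesis by (simp add: algebra_simps)
  qed
  from this[OF contact_form_fieldX] this[OF contact_form_fieldY]
  show "opX v0 p = - v2 p" "opY v0 p = v1 p"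
    by (simp_all add: deriv_along_def fieldX_def fieldY_def)
qed

text \<open>A contact map keeps the transported vector horizontal, so the variational equation
  closes up on the horizontal component \<open>h\<close>.\<close>

lemma flow_horizontal_variation:
  assumes flow: "local_flow \<Omega> V J U \<Phi>" and contact: "contact_map_on U (\<Phi> s)"
    and s: "s \<in> J" and p: "p \<in> U" and w: "contact_form p w = 0"
  defines "h \<equiv> \<lambda>r. fst (frechet_derivative (\<Phi> r) (at p) w)"
  shows "(h has_vector_derivative
    Complex (Re (h s) * opX v1 (\<Phi> s p) + Im (h s) * opY v1 (\<Phi> s p))
      (Re (h s) * opX v2 (\<Phi> s p) + Im (h s) * opY v2 (\<Phi> s p))) (at s)"
proof -
  have "\<Phi> s p \<in> \<Omega>" using flow s p unfolding local_flow_def by blast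
  then show ?thesis
    using bounded_linear.has_vector_derivative[OF bounded_linear_fst flow_variation[OF V flow s p, of w]]
      frechet_derivative_V contact_map_horizontal[OF contact p w]
    by (simp add: h_def)
qed

text \<open>At time 0 one has \<open>h = 1\<close> and \<open>k = \<i>\<close>. There
  \<open>|h|^2 - |k|^2\<close> has derivative \<open>2 X v1 - 2 Y v2\<close>, and the inner product
  of \<open>h\<close> and \<open>k\<close> has derivative \<open>Y v1 + X v2\<close>. Both functions
  vanish identically.\<close>

lemma conformal_imp_pde:
  assumes conf: "flow_consists_of conformal_map_on \<Omega> V" and p: "p \<in> \<Omega>"
  shows "opX v1 p = opY v2 p" "opY v1 p = - opX v2 p"
proof -
  obtain J U \<Phi> where flow: "p \<in> U" "local_flow \<Omega> V J U \<Phi>"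
    and conformal: "\<And>s. s \<in> J \<Longrightarrow> conformal_map_on U (\<Phi> s)"
    using conf p unfolding flow_consists_of_def by meson
  then have J: "open J" "0 \<in> J" and \<Phi>0: "\<Phi> 0 p = p"
    unfolding local_flow_def by blast+
  define h k where "h r = fst (frechet_derivative (\<Phi> r) (at p) (fieldX p))"
    and "k r = fst (frechet_derivative (\<Phi> r) (at p) (fieldY p))" for r
  have hk: "(Re (h s))\<^sup>2 + (Im (h s))\<^sup>2 - (Re (k s))\<^sup>2 - (Im (k s))\<^sup>2 = 0"
      "Re (h s) * Re (k s) + Im (h s) * Im (k s) = 0" if "s \<in> J" for s
    using conformal_map_on_iff[OF flow_differentiable[OF V flow(2) that]] conformal[OF that] flow(1)
    by (auto simp: h_def k_def Let_def)
  have contact0: "contact_map_on U (\<Phi> 0)"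
    using conformal[OF J(2)] by (simp add: conformal_map_on_def)
  have hk0: "h 0 = 1" "k 0 = \<i>"
    by (simp_all add: h_def k_def flow_derivative_0[OF V flow(2,1)] fieldX_def fieldY_def)
  have h: "(h has_vector_derivative Complex (opX v1 p) (opX v2 p)) (at 0)"
    using flow_horizontal_variation[OF flow(2) contact0 J(2) flow(1) contact_form_fieldX]
    by (simp add: h_def[symmetric] hk0 \<Phi>0)
  have k: "(k has_vector_derivative Complex (opY v1 p) (opY v2 p)) (at 0)"
    using flow_horizontal_variation[OF flow(2) contact0 J(2) flow(1) contact_form_fieldY]
    by (simp add: k_def[symmetric] hk0 \<Phi>0)
  have d: "((\<lambda>r. Re (h r)) has_real_derivative opX v1 p) (at 0)" "((\<lambda>r. Im (h r)) has_real_derivative opX v2 p) (at 0)"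
    "((\<lambda>r. Re (k r)) has_real_derivative opY v1 p) (at 0)" "((\<lambda>r. Im (k r)) has_real_derivative opY v2 p) (at 0)"
    using has_field_derivative_Re[OF h] has_field_derivative_Im[OF h]
      has_field_derivative_Re[OF k] has_field_derivative_Im[OF k] by simp_all
  have "((\<lambda>s. (Re (h s))\<^sup>2 + (Im (h s))\<^sup>2 - (Re (k s))\<^sup>2 - (Im (k s))\<^sup>2) has_real_derivative
      2 * opX v1 p - 2 * opY v2 p) (at 0)"
    by (rule derivative_eq_intros d refl)+ (simp add: hk0)
  from has_derivative_const_on_open_imp_0[OF this[unfolded has_field_derivative_def] J hk(1), of 1]
  show "opX v1 p = opY v2 p" by simp
  have "((\<lambda>s. Re (h s) * Re (k s) + Im (h s) * Im (k s)) has_real_derivative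
      opY v1 p + opX v2 p) (at 0)"
    by (rule derivative_eq_intros d refl)+ (simp add: hk0)
  from has_derivative_const_on_open_imp_0[OF this[unfolded has_field_derivative_def] J hk(2), of 1]
  show "opY v1 p = - opX v2 p" by simp
qed

lemma pde_imp_conformal:
  assumes contact: "contact_field_on \<Omega> V"
    and pde: "\<And>p. p \<in> \<Omega> \<Longrightarrow> opX v1 p = opY v2 p" "\<And>p. p \<in> \<Omega> \<Longrightarrow> opY v1 p = - opX v2 p"
  shows "flow_consists_of conformal_map_on \<Omega> V"
proof -
  have "conformal_map_on U (\<Phi> s)" if flow: "local_flow \<Omega> V J U \<Phi>" and s: "s \<in> J" for J U \<Phi> s
  proof -
    have J: "is_interval J" "0 \<in> J" and \<Phi>: "\<And>r p. r \<in> J \<Longrightarrow> p \<in> U \<Longrightarrow> \<Phi> r p \<in> \<Omega>"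
      and ode: "\<And>r p. r \<in> J \<Longrightarrow> p \<in> U \<Longrightarrow> ((\<lambda>r. \<Phi> r p) has_vector_derivative V (\<Phi> r p)) (at r)"
      using flow unfolding local_flow_def by blast+
    have contact_map: "contact_map_on U (\<Phi> r)" if "r \<in> J" for r
      using contact flow that unfolding contact_field_on_def flow_consists_of_def by blast
    \<comment> \<open>Multiplication by \<open>\<i>\<close> is a rotation by a right angle, so this
      equality contains both conformality conditions.\<close>
    have "fst (frechet_derivative (\<Phi> s) (at p) (fieldY p)) =
        \<i> * fst (frechet_derivative (\<Phi> s) (at p) (fieldX p))" if p: "p \<in> U" for p
    proof -
      define h k where "h r = fst (frechet_derivative (\<Phi> r) (at p) (fieldX p))"
        and "k r = fst (frechet_derivative (\<Phi> r) (at p) (fieldY p))" for r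
      \<comment> \<open>Under the Cauchy--Riemann system the real two by two matrix of the
        variational equation is multiplication by this complex number.\<close>
      define c where "c r = Complex (opX v1 (\<Phi> r p)) (opX v2 (\<Phi> r p))" for r
      have ops: "opY v1 (\<Phi> r p) = - opX v2 (\<Phi> r p)" "opY v2 (\<Phi> r p) = opX v1 (\<Phi> r p)" if "r \<in> J" for r
        using pde \<Phi>[OF that p] by simp_all
      have h: "(h has_vector_derivative c r * h r) (at r)" if r: "r \<in> J" for r
      proof -
        have "c r * h r = Complex (Re (h r) * opX v1 (\<Phi> r p) + Im (h r) * opY v1 (\<Phi> r p))
            (Re (h r) * opX v2 (\<Phi> r p) + Im (h r) * opY v2 (\<Phi> r p))"
          by (simp add: complex_eq_iff c_def ops[OF r])
        then show ?thesis
          using flow_horizontal_variation[OF flow contact_map[OF r] r p contact_form_fieldX]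
          by (simp add: h_def[symmetric])
      qed
      have k: "(k has_vector_derivative c r * k r) (at r)" if r: "r \<in> J" for r
      proof -
        have "c r * k r = Complex (Re (k r) * opX v1 (\<Phi> r p) + Im (k r) * opY v1 (\<Phi> r p))
            (Re (k r) * opX v2 (\<Phi> r p) + Im (k r) * opY v2 (\<Phi> r p))"
          by (simp add: complex_eq_iff c_def ops[OF r])
        then show ?thesis
          using flow_horizontal_variation[OF flow contact_map[OF r] r p contact_form_fieldY]
          by (simp add: k_def[symmetric])
      qed
      have cont: "continuous_on J (\<lambda>r. \<Phi> r p)"
        by (intro continuous_at_imp_continuous_on ballI has_vector_derivative_continuous[OF ode[OF _ p]])
      have img: "(\<lambda>r. \<Phi> r p) ` J \<subseteq> \<Omega>" using \<Phi> p by blast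
      have "continuous_on J c"
        unfolding c_def Complex_eq
        by (intro continuous_intros continuous_on_compose2[OF _ cont img] smooth_on_continuous_on
            smooth_on_opX \<Omega> smooth_v1 smooth_v2)
      \<comment> \<open>The equation is complex linear, so \<open>k - \<i> h\<close> solves it as
        well, and its initial value is \<open>\<i> - \<i> * 1 = 0\<close>.\<close>
      moreover have "((\<lambda>r. k r - \<i> * h r) has_vector_derivative c r * (k r - \<i> * h r)) (at r)" if "r \<in> J" for r
        using has_vector_derivative_diff[OF k[OF that] has_vector_derivative_mult_right[OF h[OF that], of \<i>]]
        by (simp add: algebra_simps)
      moreover have "k 0 - \<i> * h 0 = 0"
        by (simp add: h_def k_def flow_derivative_0[OF V flow p] fieldX_def fieldY_def)
      ultimately have "k s - \<i> * h s = 0"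
        using linear_ode_zero[OF J s, of c "\<lambda>r. k r - \<i> * h r"] by blast
      then show ?thesis by (simp add: h_def k_def)
    qed
    then show ?thesis
      using contact_map[OF s] by (simp add: conformal_map_on_iff[OF flow_differentiable[OF V flow s]] Let_def)
  qed
  \<comment> \<open>Existence of local flows is taken from the contact hypothesis.\<close>
  then show ?thesis
    using contact unfolding contact_field_on_def flow_consists_of_def by blast
qed

end

theorem lemma4p1:
  fixes \<Omega> :: "heis set" and V :: "heis \<Rightarrow> heis" and v0 v1 v2 :: "heis \<Rightarrow> real"
  assumes "open \<Omega>" and "connected \<Omega>" and "\<Omega> \<noteq> {}"
    and "smooth_on \<Omega> V"
    and "\<And>p. p \<in> \<Omega> \<Longrightarrow> V p = v1 p *\<^sub>R fieldX p + v2 p *\<^sub>R fieldY p - (4 * v0 p) *\<^sub>R fieldT p"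
    and "contact_field_on \<Omega> V"
  shows "(conformal_field_on \<Omega> V \<longleftrightarrow>
           (\<forall>p\<in>\<Omega>. opX (opX v0) p = opY (opY v0) p \<and> opX (opY v0) p = - opY (opX v0) p))
       \<and> (conformal_field_on \<Omega> V \<longleftrightarrow>
           (\<forall>p\<in>\<Omega>. opZ (opZ (\<lambda>q. complex_of_real (v0 q))) p = 0))
       \<and> (conformal_field_on \<Omega> V \<longleftrightarrow>
           (\<exists>c1 c2 c3 c4 c5 c6 c7 c8 :: real. \<forall>x y t. (Complex x y, t) \<in> \<Omega> \<longrightarrow>
              v0 (Complex x y, t) =
                c1 * (x^4 + 2 * x^2 * y^2 + y^4 + t^2) + c2 * (t * y - x * y^2 - x^3)
                + c3 * (t * x + x^2 * y + y^3) + c4 * (x^2 + y^2)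
                + c5 * x + c6 * y + c7 * t + c8))"
proof -
  note V = assms(1,4,5)
  note smooth = smooth_v0[OF V] smooth_v1[OF V] smooth_v2[OF V]
  let ?PDE = "\<forall>p\<in>\<Omega>. opX (opX v0) p = opY (opY v0) p \<and> opX (opY v0) p = - opY (opX v0) p"
  \<comment> \<open>By \<open>X v0 = - v2\<close> and \<open>Y v0 = v1\<close>, second derivatives
    of \<open>v0\<close> are first derivatives of \<open>v1\<close> and \<open>v2\<close>. Thus
    \<open>X v1 = Y v2\<close> reads \<open>X Y v0 = - Y X v0\<close>, and
    \<open>Y v1 = - X v2\<close> reads \<open>Y^2 v0 = X^2 v0\<close>.\<close>
  have ops: "opX (opX v0) p = - opX v2 p" "opY (opX v0) p = - opY v2 p"
    "opX (opY v0) p = opX v1 p" "opY (opY v0) p = opY v1 p" if p: "p \<in> \<Omega>" for p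
  proof -
    have X: "opX v0 q = -1 * v2 q" and Y: "opY v0 q = v1 q" if "q \<in> \<Omega>" for q
      using contact_field_partials[OF V assms(6) that] by simp_all
    show "opX (opX v0) p = - opX v2 p" "opY (opX v0) p = - opY v2 p"
      using deriv_along_cmult_on[OF assms(1) p X smooth(3)] by simp_all
    show "opX (opY v0) p = opX v1 p" "opY (opY v0) p = opY v1 p"
      by (rule deriv_along_cong[OF assms(1) p Y], assumption)+
  qed
  have "conformal_field_on \<Omega> V \<longleftrightarrow> flow_consists_of conformal_map_on \<Omega> V"
    using assms(6) by (simp add: conformal_field_on_def)
  also have "\<dots> \<longleftrightarrow> (\<forall>p\<in>\<Omega>. opX v1 p = opY v2 p \<and> opY v1 p = - opX v2 p)"
    using conformal_imp_pde[OF V] pde_imp_conformal[OF V assms(6)] by blast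
  also have "\<dots> \<longleftrightarrow> ?PDE"
    by (auto simp: ops)
  finally have 12: "conformal_field_on \<Omega> V \<longleftrightarrow> ?PDE" .
  have 23: "(\<forall>p\<in>\<Omega>. opZ (opZ (\<lambda>q. complex_of_real (v0 q))) p = 0) \<longleftrightarrow> ?PDE"
    by (auto simp: opZ_opZ_of_real[OF assms(1) smooth(1)] complex_eq_iff)
  have 24: "(\<exists>c1 c2 c3 c4 c5 c6 c7 c8. \<forall>x y t. (Complex x y, t) \<in> \<Omega> \<longrightarrow>
      v0 (Complex x y, t) = polyU c1 c2 c3 c4 c5 c6 c7 c8 x y t) \<longleftrightarrow> ?PDE" (is "?poly \<longleftrightarrow> _")
  proof
    assume ?poly
    then obtain c1 c2 c3 c4 c5 c6 c7 c8 where c: "\<And>x y t. (Complex x y, t) \<in> \<Omega> \<Longrightarrow>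
      v0 (Complex x y, t) = polyU c1 c2 c3 c4 c5 c6 c7 c8 x y t" by blast
    have "v0 q = polyU c1 c2 c3 c4 c5 c6 c7 c8 (Re (fst q)) (Im (fst q)) (snd q)" if "q \<in> \<Omega>" for q
      using c[of "Re (fst q)" "Im (fst q)" "snd q"] that by simp
    from polyU_conformal[OF assms(1) _ this] show ?PDE by blast
  next
    assume ?PDE
    then obtain c1 c2 c3 c4 c5 c6 c7 c8 where c: "\<And>q. q \<in> \<Omega> \<Longrightarrow>
      v0 q = polyU c1 c2 c3 c4 c5 c6 c7 c8 (Re (fst q)) (Im (fst q)) (snd q)"
      using pde_solution[OF assms(1) smooth(1) _ _ assms(2)] by blast
    have "\<forall>x y t. (Complex x y, t) \<in> \<Omega> \<longrightarrow> v0 (Complex x y, t) = polyU c1 c2 c3 c4 c5 c6 c7 c8 x y t"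
      using c by simp
    then show ?poly by blast
  qed
  show ?thesis
    unfolding polyU_def[symmetric] using 12 23 24 by simp
qed

end
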